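(* Let $A\in\mathbb{R}^{m\times n}$ and $b\in\mathbb{R}^m$ be such that $Ax=b$ is consistent, let $B\in\mathbb{R}^{n\times n}$ be symmetric positive definite, and let $\{x^k\}_{k\ge0}$ be the random iterates of the randomized iterative method defined in the context, started from $x^0\in\mathbb{R}^n$. For every $x^*\in\mathbb{R}^n$ satisfying $Ax^*=b$ and every $k\ge 0$ we have $$\mathbf{E}[x^{k+1}-x^*]=\left(I-B^{-1}\mathbf{E}[Z]\right)\mathbf{E}[x^k-x^*].$$ Moreover, the spectral radius and the induced $B$-norm of the iteration matrix $I-B^{-1}\mathbf{E}[Z]$ are both equal to $\rho$: $$\lambda_{\max}(I-B^{-1}\mathbf{E}[Z])=\|I-B^{-1}\mathbf{E}[Z]\|_B=\rho.$$ Therefore, for every $k\ge 0$, $$\left\|\mathbf{E}[x^k-x^*]\right\|_B\le\rho^k\|x^0-x^*\|_B.$$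
   Context: $M^\dagger$ is the Moore-Penrose pseudoinverse; $\|x\|_B=\sqrt{x^TBx}$ for $x\in\mathbb{R}^n$, and $\|M\|_B=\max_{\|x\|_B=1}\|Mx\|_B$ for $M\in\mathbb{R}^{n\times n}$. Method: let $S$ be a random real matrix with $m$ rows and $q$ columns ($q$ may be random). At each iteration $k\ge0$ an independent copy $S_k$ of $S$ is drawn (i.i.d. across iterations), and $$x^{k+1}=x^k-B^{-1}A^TS_k(S_k^TAB^{-1}A^TS_k)^{\dagger}S_k^T(Ax^k-b).$$ Set $Z=A^TS(S^TAB^{-1}A^TS)^{\dagger}S^TA$ and $$\rho=1-\lambda_{\min}(B^{-1/2}\mathbf{E}[Z]B^{-1/2})=1-\lambda_{\min}(B^{-1}\mathbf{E}[Z]),$$ where $\lambda_{\min},\lambda_{\max}$ denote the smallest and largest eigenvalues (the eigenvalues of $B^{-1}\mathbf{E}[Z]$ are real since it is similar to the symmetric matrix $B^{-1/2}\mathbf{E}[Z]B^{-1/2}$). *)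

theory Defs
  imports
    "HOL-Probability.Probability"
    "Jordan_Normal_Form.Spectral_Radius"
begin

unbundle no vec_syntax

text \<open>Matrices and vectors are those of \<^theory>\<open>Jordan_Normal_Form.Matrix\<close>, whose dimensions are
  part of the value: the number of columns of the random matrix $S$ may itself be random.\<close>

text \<open>Moore-Penrose pseudoinverse, characterised by the four Penrose equations.\<close>

definition pinv :: "real mat \<Rightarrow> real mat" where
  "pinv M = (THE X. X \<in> carrier_mat (dim_col M) (dim_row M) \<and>
     M * X * M = M \<and> X * M * X = X \<and>
     transpose_mat (M * X) = M * X \<and> transpose_mat (X * M) = X * M)"

definition mat_inv :: "real mat \<Rightarrow> real mat" where
  "mat_inv M = the (mat_inverse M)"

definition sym_pos_def :: "nat \<Rightarrow> real mat \<Rightarrow> bool" where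
  "sym_pos_def n P \<longleftrightarrow> P \<in> carrier_mat n n \<and> transpose_mat P = P \<and>
     (\<forall>v \<in> carrier_vec n. v \<noteq> 0\<^sub>v n \<longrightarrow> v \<bullet> (P *\<^sub>v v) > 0)"

text \<open>$P^{1/2}$ for symmetric positive definite $P$: the symmetric positive definite root.\<close>

definition mat_sqrt :: "real mat \<Rightarrow> real mat" where
  "mat_sqrt P = (THE R. sym_pos_def (dim_row P) R \<and> R * R = P)"

text \<open>Only applied to matrices with real spectrum, so no eigenvalue is lost by taking
  the spectrum over the reals.\<close>

definition lambda_min :: "real mat \<Rightarrow> real" where
  "lambda_min M = Min (spectrum M)"

definition lambda_max :: "real mat \<Rightarrow> real" where
  "lambda_max M = Max (spectrum M)"

definition vec_norm_wrt :: "real mat \<Rightarrow> real vec \<Rightarrow> real" where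
  "vec_norm_wrt B x = sqrt (x \<bullet> (B *\<^sub>v x))"

text \<open>The maximum in $\max_{\|x\|_B = 1} \|Mx\|_B$ ranges over an infinite set, whence
  \<^const>\<open>Greatest\<close> instead of \<^const>\<open>Max\<close>.\<close>

definition mat_norm_wrt :: "real mat \<Rightarrow> real mat \<Rightarrow> real" where
  "mat_norm_wrt B M = (GREATEST r. \<exists>x \<in> carrier_vec (dim_row B).
     vec_norm_wrt B x = 1 \<and> r = vec_norm_wrt B (M *\<^sub>v x))"

text \<open>The measurable space of real matrices with \<open>m\<close> rows and any number of columns: the disjoint
  union over \<open>q\<close> of the Borel spaces of $m \times q$ matrices.\<close>

definition borel_rows :: "nat \<Rightarrow> real mat measure" where
  "borel_rows m = sigma (\<Union>q. carrier_mat m q)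
     (range (carrier_mat m) \<union>
      {{X \<in> carrier_mat m q. X $$ (i, j) \<le> a} | q i j a. i < m \<and> j < q})"

text \<open>Expectations of random vectors and matrices are taken entrywise.\<close>

definition expectation_vec :: "'w measure \<Rightarrow> nat \<Rightarrow> ('w \<Rightarrow> real vec) \<Rightarrow> real vec" where
  "expectation_vec M n X = Matrix.vec n (\<lambda>i. integral\<^sup>L M (\<lambda>\<omega>. X \<omega> $ i))"

definition expectation_mat :: "'w measure \<Rightarrow> nat \<Rightarrow> nat \<Rightarrow> ('w \<Rightarrow> real mat) \<Rightarrow> real mat" where
  "expectation_mat M nr nc X =
     Matrix.mat nr nc (\<lambda>(i, j). integral\<^sup>L M (\<lambda>\<omega>. X \<omega> $$ (i, j)))"

definition sketch_Z :: "real mat \<Rightarrow> real mat \<Rightarrow> real mat \<Rightarrow> real mat" where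
  "sketch_Z A B S = transpose_mat A * S *
     pinv (transpose_mat S * A * mat_inv B * transpose_mat A * S) * transpose_mat S * A"

primrec iterate ::
  "real mat \<Rightarrow> real vec \<Rightarrow> real mat \<Rightarrow> real vec \<Rightarrow> (nat \<Rightarrow> real mat) \<Rightarrow> nat \<Rightarrow> real vec" where
  "iterate A b B x0 S 0 = x0"
| "iterate A b B x0 S (Suc k) = iterate A b B x0 S k -
     (mat_inv B * transpose_mat A * S k *
       pinv (transpose_mat (S k) * A * mat_inv B * transpose_mat A * S k) * transpose_mat (S k))
     *\<^sub>v (A *\<^sub>v iterate A b B x0 S k - b)"

text \<open>The rate $\rho = 1 - \lambda_{\min}(B^{-1/2} \mathbf{E}[Z] B^{-1/2})$.\<close>

definition rate :: "real mat \<Rightarrow> real mat \<Rightarrow> real" where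
  "rate B EZ = 1 - lambda_min (mat_inv (mat_sqrt B) * EZ * mat_inv (mat_sqrt B))"

end

theory Submission
  imports Defs
begin

text \<open>Put \<open>R = B\<^sup>1\<^sup>/\<^sup>2\<close> and \<open>C = R\<inverse> A\<^sup>T S\<close>. Then \<open>Z = R P R\<close>, where \<open>P = C (C\<^sup>T C)\<^sup>\<dagger> C\<^sup>T\<close> is the
  orthogonal projection onto the range of \<open>C\<close>, and one step of the method turns the error \<open>e\<close> into
  \<open>(I - B\<inverse> Z) e\<close>. The entries of \<open>Z\<close> are bounded, and they are measurable because \<open>P\<close> is the limit of
  \<open>I - (I - a C C\<^sup>T)\<^sup>k\<close> for small \<open>a > 0\<close>; as \<open>S\<^sub>k\<close> is independent of the error after \<open>k\<close> steps, the expectation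
  of the product factorizes. Finally \<open>I - B\<inverse> E[Z] = R\<inverse> (I - E[P]) R\<close>, and the eigenvalues of the
  symmetric matrix \<open>E[P]\<close> lie in \<open>[0, 1]\<close>, so that all three quantities equal \<open>1 - \<lambda>\<^sub>m\<^sub>i\<^sub>n (E[P])\<close>.\<close>

section \<open>Spectral theorem for real symmetric matrices\<close>

text \<open>The pseudoinverse is not a continuous function of its argument, and the size of S^T A
  B^{-1} A^T S varies with the number of columns of S. Both difficulties disappear because P depends
  only on C C^T, a matrix of fixed size n x n: P has the same eigenvectors, with every nonzero
  eigenvalue replaced by 1. Entries of P are at most 1 in modulus whatever S is, so for each k the
  error after k steps is bounded by a constant, and all expectations exist. The matrix R is an
  isometry from the B-norm to the Euclidean norm, so the B-norm of the iteration matrix is the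
  Euclidean operator norm of the symmetric matrix I - E[P]; as its eigenvalues are nonnegative, the
  largest of them is both its norm and its spectral radius. The spectral theorem is what turns
  inverses, pseudoinverses, square roots, powers and limits of a symmetric matrix into operations on
  its eigenvalues.\<close>

unbundle no inner_syntax

declare assoc_mult_mat [simp del] assoc_mult_mat_vec [simp del]

text \<open>The carrier-based rules of the library have a schematic inner dimension, which the
  simplifier cannot guess; the following variants only compare the dimensions of the operands.\<close>

lemma mult_carrier_mat_dim:
  "dim_row A = nr \<Longrightarrow> dim_col B = nc \<Longrightarrow> A * B \<in> carrier_mat nr nc"
  by (intro carrier_matI) simp_all

lemma mult_carrier_vec_dim: "dim_row A = n \<Longrightarrow> A *\<^sub>v v \<in> carrier_vec n"
  by (intro carrier_vecI) simp

lemma assoc_mult_mat_dim: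
  "dim_col A = dim_row B \<Longrightarrow> dim_col B = dim_row C \<Longrightarrow> (A * B) * C = A * (B * C)"
  by (rule assoc_mult_mat[of A "dim_row A" "dim_col A" B "dim_col B" C "dim_col C"])
    (intro carrier_matI; simp)+

lemma assoc_mult_mat_vec_dim:
  "dim_col A = dim_row B \<Longrightarrow> dim_col B = dim_vec v \<Longrightarrow> (A * B) *\<^sub>v v = A *\<^sub>v (B *\<^sub>v v)"
  by (rule assoc_mult_mat_vec[of A "dim_row A" "dim_col A" B "dim_col B"])
    (intro carrier_matI carrier_vecI; simp)+

lemma transpose_mult_dim:
  fixes A :: "'a :: comm_semiring_0 mat"
  shows "dim_col A = dim_row B \<Longrightarrow> transpose_mat (A * B) = transpose_mat B * transpose_mat A"
  by (rule transpose_mult[of A "dim_row A" "dim_col A" B "dim_col B"]) (intro carrier_matI; simp)+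

lemma one_mult_mat_dim:
  fixes A :: "'a :: semiring_1 mat"
  shows "dim_row A = n \<Longrightarrow> 1\<^sub>m n * A = A" "dim_col A = n \<Longrightarrow> A * 1\<^sub>m n = A"
proof -
  show "1\<^sub>m n * A = A" if "dim_row A = n"
    using that by (intro left_mult_one_mat[of A n "dim_col A"] carrier_matI) simp_all
  show "A * 1\<^sub>m n = A" if "dim_col A = n"
    using that by (intro right_mult_one_mat[of A "dim_row A" n] carrier_matI) simp_all
qed

lemmas mat_dim = assoc_mult_mat_dim assoc_mult_mat_vec_dim transpose_mult_dim one_mult_mat_dim
  mult_carrier_mat_dim mult_carrier_vec_dim

lemma mat_diag_dims [simp]: "dim_row (mat_diag n f) = n" "dim_col (mat_diag n f) = n"
  by (auto simp: mat_diag_def)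

lemma symmetric_mat_index:
  assumes "A \<in> carrier_mat n n" and t: "transpose_mat A = A" and "i < n" "j < n"
  shows "A $$ (i, j) = A $$ (j, i)"
proof -
  have "transpose_mat A $$ (i, j) = A $$ (j, i)"
    using assms(1,3,4) by (intro index_transpose_mat(1)) auto
  then show ?thesis by (simp only: t)
qed

lemma scalar_prod_self_nonneg: "(x :: real vec) \<bullet> x \<ge> 0"
  by (auto simp: scalar_prod_def intro: sum_nonneg)

lemma scalar_prod_self_eq_0:
  assumes x: "(x :: real vec) \<in> carrier_vec n" "x \<bullet> x = 0"
  shows "x = 0\<^sub>v n"
proof (rule eq_vecI)
  fix i assume "i < dim_vec (0\<^sub>v n :: real vec)"
  then have i: "i < n" by simp
  have "(\<Sum>i = 0..<n. x $ i * x $ i) = 0" using x by (simp add: scalar_prod_def)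
  then have "\<forall>i\<in>{0..<n}. x $ i * x $ i = 0"
    by (subst (asm) sum_nonneg_eq_0_iff) auto
  then show "x $ i = 0\<^sub>v n $ i" using i by simp
qed (use x in simp)

lemma scalar_prod_self_pos:
  assumes "(x :: real vec) \<in> carrier_vec n" "x \<noteq> 0\<^sub>v n"
  shows "x \<bullet> x > 0"
  using scalar_prod_self_eq_0[OF assms(1)] assms(2) scalar_prod_self_nonneg[of x]
  by (metis order_le_less)

text \<open>The witness is the Householder reflection that exchanges \<^term>\<open>v\<close> and the first unit vector.\<close>

lemma orthogonal_mat_unit_vec_0:
  fixes v :: "real vec"
  assumes v: "v \<in> carrier_vec n" "v \<bullet> v = 1" and n: "n > 0"
  obtains W where "W \<in> carrier_mat n n" "transpose_mat W = W" "W * W = 1\<^sub>m n"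
    "W *\<^sub>v unit_vec n 0 = v"
proof (cases "v = unit_vec n 0")
  case True
  show ?thesis by (rule that[of "1\<^sub>m n"]) (auto simp: True)
next
  case False
  define u where "u = v - unit_vec n 0"
  have u: "u \<in> carrier_vec n" using v by (auto simp: u_def)
  \<comment> \<open>Both \<open>v\<close> and the unit vector have norm 1, so u.u = 2 - 2 v_0, while
    u_0 = v_0 - 1.\<close>
  have uu: "u \<bullet> u = - 2 * (u $ 0)"
    using v n by (simp add: u_def minus_scalar_prod_distrib[of _ n] scalar_prod_minus_distrib[of _ n])
  have "u \<noteq> 0\<^sub>v n"
  proof
    assume "u = 0\<^sub>v n"
    then have "v $ i - unit_vec n 0 $ i = 0" if "i < n" for i
      proof -
      have "u $ i = 0" using that by (simp add: \<open>u = 0\<^sub>v n\<close>)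
      then show ?thesis using that v by (simp add: u_def del: index_unit_vec(1,2))
    qed
    then have "v = unit_vec n 0" using v by (intro eq_vecI) simp_all
    with False show False by contradiction
  qed
  then have upos: "u \<bullet> u > 0" by (rule scalar_prod_self_pos[OF u])
  define c where "c = 2 / (u \<bullet> u)"
  have cuu: "c * (u \<bullet> u) = 2" using upos by (simp add: c_def)
  \<comment> \<open>This value makes the first column of \<open>W\<close> equal to the unit vector
    plus \<open>u\<close>, which is \<open>v\<close>.\<close>
  have cu0: "c * u $ 0 = - 1" using uu cuu by (simp add: algebra_simps)
  define W where "W = Matrix.mat n n (\<lambda>(i, j). (if i = j then 1 else 0) - c * u $ i * u $ j)"
  have W: "W \<in> carrier_mat n n" by (simp add: W_def)
  have Wt: "transpose_mat W = W" by (intro eq_matI) (simp_all add: W_def)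
  have "W * W = 1\<^sub>m n"
  proof (rule eq_matI)
    fix i j assume "i < dim_row (1\<^sub>m n :: real mat)" "j < dim_col (1\<^sub>m n :: real mat)"
    then have ij: "i < n" "j < n" by auto
    have W_index: "W $$ (k, l) = (if k = l then 1 else 0) - c * u $ k * u $ l" if "k < n" "l < n" for k l
      using that by (simp add: W_def)
    \<comment> \<open>The reflection sends \<open>u\<close> to its negative. Expanding only the left
      factor of \<open>W * W\<close> reduces the product to this sum.\<close>
    have uW: "(\<Sum>k<n. u $ k * W $$ (k, j)) = - u $ j"
    proof -
      have "(\<Sum>k<n. u $ k * W $$ (k, j)) = (\<Sum>k<n. (if k = j then u $ j else 0) - c * u $ j * (u $ k * u $ k))"
        using ij by (intro sum.cong refl) (simp add: W_index right_diff_distrib)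
      also have "\<dots> = u $ j - c * u $ j * (u \<bullet> u)"
        using u ij by (simp add: sum_subtractf sum_distrib_left scalar_prod_def lessThan_atLeast0)
      also have "c * u $ j * (u \<bullet> u) = (c * (u \<bullet> u)) * u $ j" by (simp only: ac_simps)
      finally show ?thesis by (simp add: cuu)
    qed
    have "(W * W) $$ (i, j) = (\<Sum>k<n. W $$ (i, k) * W $$ (k, j))"
      using ij W by (simp add: scalar_prod_def lessThan_atLeast0)
    also have "\<dots> = (\<Sum>k<n. (if k = i then W $$ (i, j) else 0) - c * u $ i * (u $ k * W $$ (k, j)))"
      using ij(1) by (intro sum.cong refl) (simp add: W_index[of i] left_diff_distrib)
    also have "\<dots> = W $$ (i, j) + c * u $ i * u $ j"
      using ij by (simp add: sum_subtractf sum_distrib_left[symmetric] uW)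
    finally show "(W * W) $$ (i, j) = 1\<^sub>m n $$ (i, j)"
      using ij by (simp add: W_index)
  qed (auto simp: W_def)
  moreover have "W *\<^sub>v unit_vec n 0 = v"
  proof (rule eq_vecI)
    fix i assume "i < dim_vec v"
    then have i: "i < n" using v by auto
    have "(W *\<^sub>v unit_vec n 0) $ i = W $$ (i, 0)"
      using i n W by simp
    also have "\<dots> = (if i = 0 then 1 else 0) - (c * u $ 0) * u $ i"
      using i n by (simp add: W_def)
    also have "\<dots> = (if i = 0 then 1 else 0) + u $ i" by (simp add: cu0)
    also have "\<dots> = v $ i" using i n v by (simp add: u_def)
    finally show "(W *\<^sub>v unit_vec n 0) $ i = v $ i" .
  qed (use v in \<open>auto simp: W_def\<close>)
  ultimately show ?thesis using W Wt that by blast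
qed

text \<open>Over the complex numbers an eigenvalue \<open>l\<close> with eigenvector
  \<open>v\<close> exists. The Hermitian form of the matrix at \<open>v\<close> is both
  \<open>l\<close> and \<open>cnj l\<close> times the nonzero square norm of \<open>v\<close>, so
  \<open>l\<close> is real, and it is a root of the real characteristic polynomial.\<close>

lemma symmetric_mat_real_eigenvalue:
  fixes A :: "real mat"
  assumes A: "A \<in> carrier_mat n n" "transpose_mat A = A" and n: "n > 0"
  obtains e where "eigenvalue A e"
proof -
  let ?A = "map_mat complex_of_real A"
  have cA: "?A \<in> carrier_mat n n" using A by simp
  obtain l where l: "eigenvalue ?A l"
    using spectrum_non_empty[OF cA n] by (auto simp: spectrum_def)
  then obtain v where v: "v \<in> carrier_vec n" "v \<noteq> 0\<^sub>v n" "?A *\<^sub>v v = l \<cdot>\<^sub>v v"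
    using cA by (auto simp: eigenvalue_def eigenvector_def)
  have At: "transpose_mat ?A = ?A"
    using A(1) by (intro eq_matI) (auto simp: symmetric_mat_index[OF A])
  have conj: "conjugate (?A *\<^sub>v v) = ?A *\<^sub>v conjugate v"
    using v(1) A(1) by (intro eq_vecI) (auto simp: scalar_prod_def)
  have "l * (conjugate v \<bullet> v) = conjugate v \<bullet> (?A *\<^sub>v v)"
    using v by (simp add: carrier_vec_conjugate)
  also have "\<dots> = (?A *\<^sub>v conjugate v) \<bullet> v"
    using transpose_vec_mult_scalar[OF cA v(1) carrier_vec_conjugate[OF v(1)]] At by simp
  also have "\<dots> = conjugate (l \<cdot>\<^sub>v v) \<bullet> v" using conj v by simp
  also have "\<dots> = cnj l * (conjugate v \<bullet> v)"
    using v by (simp add: conjugate_smult_vec carrier_vec_conjugate)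
  finally have "(l - cnj l) * (conjugate v \<bullet> v) = 0" by (simp add: algebra_simps)
  moreover have "conjugate v \<bullet> v \<noteq> 0"
    using v conjugate_square_eq_0_vec[OF v(1)] comm_scalar_prod[OF v(1) carrier_vec_conjugate[OF v(1)]]
    by simp
  ultimately have "l = cnj l" by simp
  then have l': "l = of_real (Re l)" by (simp add: complex_eq_iff)
  have "poly (char_poly ?A) l = 0" using l eigenvalue_root_char_poly[OF cA] by simp
  then have "poly (map_poly of_real (char_poly A)) (of_real (Re l)) = (0 :: complex)"
    using of_real_hom.char_poly_hom[OF A(1)] l' by metis
  then have "poly (char_poly A) (Re l) = 0" by simp
  then show ?thesis using that eigenvalue_root_char_poly[OF A(1)] by blast
qed

text \<open>Deflation: conjugating with the reflection \<open>W\<close> that maps the first unit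
  vector to a unit eigenvector makes that unit vector an eigenvector. The first column then vanishes
  below the diagonal, by symmetry so does the rest of the first row, and the induction hypothesis
  applies to the remaining block \<open>A3\<close>.\<close>

theorem symmetric_mat_spectral:
  fixes A :: "real mat"
  assumes "A \<in> carrier_mat n n" "transpose_mat A = A"
  obtains U d where "U \<in> carrier_mat n n" "transpose_mat U * U = 1\<^sub>m n"
    "A = U * mat_diag n d * transpose_mat U"
  using assms
proof (induction n arbitrary: A thesis)
  case 0
  show ?case by (rule 0(1)[of "1\<^sub>m 0" "\<lambda>_. 0"]) (use 0 in auto)
next
  case (Suc n A)
  let ?m = "Suc n"
  obtain e where "eigenvalue A e"
    using symmetric_mat_real_eigenvalue[OF Suc.prems(2,3)] by blast
  then obtain w where w: "w \<in> carrier_vec ?m" "w \<noteq> 0\<^sub>v ?m" "A *\<^sub>v w = e \<cdot>\<^sub>v w"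
    using Suc.prems by (auto simp: eigenvalue_def eigenvector_def)
  have wpos: "w \<bullet> w > 0" using scalar_prod_self_pos w by blast
  define v where "v = (1 / sqrt (w \<bullet> w)) \<cdot>\<^sub>v w"
  have v: "v \<in> carrier_vec ?m" "v \<bullet> v = 1" using w wpos by (auto simp: v_def)
  have Av: "A *\<^sub>v v = e \<cdot>\<^sub>v v"
    using w Suc.prems(2) by (simp add: v_def mult_mat_vec[of _ ?m ?m] smult_smult_assoc mult.commute)
  obtain W where W: "W \<in> carrier_mat ?m ?m" "transpose_mat W = W" "W * W = 1\<^sub>m ?m"
    "W *\<^sub>v unit_vec ?m 0 = v"
    using orthogonal_mat_unit_vec_0[OF v] by blast
  note A = Suc.prems(2,3)
  define A' where "A' = W * A * W"
  have A': "A' \<in> carrier_mat ?m ?m" using W A by (simp add: A'_def mat_dim)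
  have A't: "transpose_mat A' = A'"
    using W A by (simp add: A'_def mat_dim)
  have Wv: "W *\<^sub>v v = unit_vec ?m 0"
    using W(1,3) by (simp add: W(4)[symmetric] assoc_mult_mat_vec_dim[symmetric])
  have "A' *\<^sub>v unit_vec ?m 0 = W *\<^sub>v (A *\<^sub>v (W *\<^sub>v unit_vec ?m 0))"
    using W A v by (simp add: A'_def mat_dim)
  also have "\<dots> = e \<cdot>\<^sub>v unit_vec ?m 0" using W v by (simp add: Av mult_mat_vec[of _ ?m ?m] Wv)
  finally have A'e: "A' *\<^sub>v unit_vec ?m 0 = e \<cdot>\<^sub>v unit_vec ?m 0" .
  have A'0: "A' $$ (i, 0) = (if i = 0 then e else 0)" if "i < ?m" for i
    using arg_cong[OF A'e, of "\<lambda>x. x $ i"] that A' by auto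
  have A'sym: "A' $$ (j, i) = A' $$ (i, j)" if "i < ?m" "j < ?m" for i j
    using symmetric_mat_index[OF A' A't] that by blast
  have A'0': "A' $$ (0, i) = (if i = 0 then e else 0)" if "i < ?m" for i
    using A'0[OF that] A'sym[OF that, of 0] by simp
  define A3 where "A3 = Matrix.mat n n (\<lambda>(i, j). A' $$ (Suc i, Suc j))"
  have A3: "A3 \<in> carrier_mat n n" by (simp add: A3_def)
  have A3t: "transpose_mat A3 = A3"
    by (intro eq_matI) (auto simp: A3_def A'sym)
  obtain U d where U: "U \<in> carrier_mat n n" "transpose_mat U * U = 1\<^sub>m n"
    "A3 = U * mat_diag n d * transpose_mat U"
    using Suc.IH[OF _ A3 A3t] by blast
  let ?d = "\<lambda>i. case i of 0 \<Rightarrow> e | Suc j \<Rightarrow> d j"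
  let ?Z = "0\<^sub>m 1 n :: real mat" and ?Z' = "0\<^sub>m n 1 :: real mat"
  define E where "E = mat_diag 1 (\<lambda>_. e)"
  have E: "E \<in> carrier_mat 1 1" by (simp add: E_def)
  define V where "V = four_block_mat (1\<^sub>m 1) ?Z ?Z' U"
  have V: "V \<in> carrier_mat ?m ?m" using U four_block_carrier_mat[of "1\<^sub>m 1" 1 1 U n n] by (simp add: V_def)
  have Vt: "transpose_mat V = four_block_mat (1\<^sub>m 1) ?Z ?Z' (transpose_mat U)"
    using U by (simp add: V_def transpose_four_block_mat[of _ 1 1 _ n _ n])
  have VtV: "transpose_mat V * V = 1\<^sub>m ?m"
    unfolding Vt using U four_block_one_mat[of 1 n]
    by (simp add: V_def mult_four_block_mat[of _ 1 1 _ n _ n _ _ 1 _ n])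
  have D: "mat_diag ?m ?d = four_block_mat E ?Z ?Z' (mat_diag n d)"
    by (intro eq_matI) (auto simp: mat_diag_def E_def split: nat.split)
  have A'block: "A' = four_block_mat E ?Z ?Z' A3"
    using A' by (intro eq_matI) (auto simp: E_def A3_def A'0 A'0' mat_diag_def)
  have A'V: "A' = V * mat_diag ?m ?d * transpose_mat V"
  proof -
    have "V * mat_diag ?m ?d = four_block_mat E ?Z ?Z' (U * mat_diag n d)"
      unfolding D V_def using U(1) E
      by (subst mult_four_block_mat[of _ 1 1 _ n _ n _ _ 1 _ n])
        (simp_all add: mat_dim left_mult_zero_mat[OF mat_diag_dim])
    then have "V * mat_diag ?m ?d * transpose_mat V
        = four_block_mat E ?Z ?Z' (U * mat_diag n d) * four_block_mat (1\<^sub>m 1) ?Z ?Z' (transpose_mat U)"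
      by (simp only: Vt)
    also have "\<dots> = A'"
      unfolding A'block U(3) using U(1) E
      by (subst mult_four_block_mat[of _ 1 1 _ n _ n _ _ 1 _ n])
        (simp_all add: mat_dim right_mult_zero_mat[of _ n n])
    finally show ?thesis by simp
  qed
  have "A = W * A' * W"
  proof -
    have "W * A' * W = (W * W) * A * (W * W)"
      using W(1) A by (simp add: A'_def mat_dim)
    then show ?thesis using A W by (simp add: mat_dim)
  qed
  then have *: "A = (W * V) * mat_diag ?m ?d * transpose_mat (W * V)"
    using W V by (simp add: A'V mat_dim)
  have "transpose_mat (W * V) * (W * V) = transpose_mat V * (W * W) * V"
    using W(1,2) V by (simp add: mat_dim)
  then have "transpose_mat (W * V) * (W * V) = 1\<^sub>m ?m" using W V VtV by (simp add: mat_dim)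
  moreover have "W * V \<in> carrier_mat ?m ?m" using W V by (simp add: mat_dim)
  ultimately show ?case using Suc.prems(1) * by blast
qed

section \<open>Functional calculus in a fixed orthonormal basis\<close>

locale orthogonal_mat =
  fixes n :: nat and U :: "real mat"
  assumes U [simp]: "U \<in> carrier_mat n n" and UtU [simp]: "transpose_mat U * U = 1\<^sub>m n"
begin

lemma U_dim [simp]: "dim_row U = n" "dim_col U = n"
  using carrier_matD[OF U] by blast+

lemma UUt [simp]: "U * transpose_mat U = 1\<^sub>m n"
  by (rule mat_mult_left_right_inverse[of _ n]) auto

text \<open>The symmetric matrix whose eigenvectors are the columns of \<open>U\<close>, with
  eigenvalues \<open>f\<close>. Products, differences, multiples and powers act pointwise on
  \<open>f\<close>, so identities between matrices that share an eigenbasis reduce to scalar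
  identities.\<close>

definition udiag :: "(nat \<Rightarrow> real) \<Rightarrow> real mat" where
  "udiag f = U * mat_diag n f * transpose_mat U"

lemma udiag_carrier [simp]: "udiag f \<in> carrier_mat n n"
  by (simp add: udiag_def mat_dim)

lemma udiag_dim [simp]: "dim_row (udiag f) = n" "dim_col (udiag f) = n"
  by (simp_all add: udiag_def)

lemma udiag_mult: "udiag f * udiag g = udiag (\<lambda>i. f i * g i)"
proof -
  have "udiag f * udiag g = U * mat_diag n f * (transpose_mat U * U) * mat_diag n g * transpose_mat U"
    by (simp add: udiag_def mat_dim del: UtU)
  also have "\<dots> = U * (mat_diag n f * mat_diag n g) * transpose_mat U"
    by (simp add: mat_dim del: mat_diag_diag)
  finally show ?thesis by (simp add: udiag_def)
qed

lemma udiag_one: "udiag (\<lambda>_. 1) = 1\<^sub>m n"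
  by (simp add: udiag_def mat_dim)

lemma udiag_index:
  assumes "i < n" "j < n"
  shows "udiag f $$ (i, j) = (\<Sum>l<n. U $$ (i, l) * f l * U $$ (j, l))"
proof -
  have "U * mat_diag n f = Matrix.mat n n (\<lambda>(i, j). U $$ (i, j) * f j)"
    by (rule mat_diag_mult_right) simp
  then show ?thesis
    using assms by (simp add: udiag_def scalar_prod_def lessThan_atLeast0)
qed

lemma udiag_transpose: "transpose_mat (udiag f) = udiag f"
  by (intro eq_matI) (auto simp: udiag_index intro!: sum.cong)

lemma udiag_minus: "udiag f - udiag g = udiag (\<lambda>i. f i - g i)"
  by (intro eq_matI) (auto simp: udiag_index sum_subtractf algebra_simps)

lemma udiag_smult: "c \<cdot>\<^sub>m udiag f = udiag (\<lambda>i. c * f i)"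
  by (intro eq_matI) (auto simp: udiag_index sum_distrib_left intro!: sum.cong)

lemma udiag_pow: "udiag f ^\<^sub>m k = udiag (\<lambda>i. f i ^ k)"
  by (induction k) (auto simp: udiag_one udiag_mult mult.commute)

lemma udiag_cong: "(\<And>i. i < n \<Longrightarrow> f i = g i) \<Longrightarrow> udiag f = udiag g"
  by (intro eq_matI) (auto simp: udiag_index)

lemma udiag_quadratic:
  assumes x: "x \<in> carrier_vec n"
  shows "x \<bullet> (udiag f *\<^sub>v x) = (\<Sum>l<n. f l * ((transpose_mat U *\<^sub>v x) $ l)\<^sup>2)"
proof -
  let ?y = "transpose_mat U *\<^sub>v x"
  have y: "?y \<in> carrier_vec n" using x by (simp add: mat_dim)
  have "x \<bullet> (udiag f *\<^sub>v x) = x \<bullet> (U *\<^sub>v (mat_diag n f *\<^sub>v ?y))"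
    using x by (simp add: udiag_def mat_dim)
  also have "\<dots> = ?y \<bullet> (mat_diag n f *\<^sub>v ?y)"
    using x by (intro transpose_vec_mult_scalar[symmetric, of _ n n]) (auto simp: mat_dim)
  also have "mat_diag n f *\<^sub>v ?y = Matrix.vec n (\<lambda>l. f l * ?y $ l)"
    using y by (intro eq_vecI)
      (auto simp: mat_diag_def scalar_prod_def if_distrib[of "\<lambda>a. a * _"] cong: if_cong)
  also have "?y \<bullet> \<dots> = (\<Sum>l<n. f l * (?y $ l)\<^sup>2)"
    by (auto simp: scalar_prod_def power2_eq_square lessThan_atLeast0 algebra_simps intro!: sum.cong)
  finally show ?thesis .
qed

lemma udiag_norm:
  assumes x: "x \<in> carrier_vec n"
  shows "(udiag f *\<^sub>v x) \<bullet> (udiag f *\<^sub>v x) = (\<Sum>l<n. (f l)\<^sup>2 * ((transpose_mat U *\<^sub>v x) $ l)\<^sup>2)"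
proof -
  have "(udiag f *\<^sub>v x) \<bullet> (udiag f *\<^sub>v x) = x \<bullet> (udiag f *\<^sub>v (udiag f *\<^sub>v x))"
    using transpose_vec_mult_scalar[of "udiag f" n n "udiag f *\<^sub>v x" x] x by (simp add: udiag_transpose mat_dim)
  also have "udiag f *\<^sub>v (udiag f *\<^sub>v x) = udiag (\<lambda>l. (f l)\<^sup>2) *\<^sub>v x"
    using x by (simp add: assoc_mult_mat_vec_dim[symmetric] udiag_mult power2_eq_square)
  finally show ?thesis by (simp add: udiag_quadratic x)
qed

lemma parseval:
  assumes x: "x \<in> carrier_vec n"
  shows "x \<bullet> x = (\<Sum>l<n. ((transpose_mat U *\<^sub>v x) $ l)\<^sup>2)"
  using udiag_quadratic[OF x, of "\<lambda>_. 1"] x by (simp add: udiag_one)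

lemma col_coords:
  assumes "l < n"
  shows "transpose_mat U *\<^sub>v Matrix.col U l = unit_vec n l"
proof -
  have "transpose_mat U *\<^sub>v Matrix.col U l = Matrix.col (transpose_mat U * U) l"
    using assms by (intro eq_vecI) (auto simp del: UtU)
  then show ?thesis using assms by simp
qed

lemma col_norm: "l < n \<Longrightarrow> Matrix.col U l \<bullet> Matrix.col U l = 1"
  using U by (subst parseval) (auto simp: col_coords if_distrib[of "\<lambda>a. a ^ 2"] cong: if_cong)

lemma udiag_col:
  assumes "l < n"
  shows "udiag f *\<^sub>v Matrix.col U l = f l \<cdot>\<^sub>v Matrix.col U l"
proof -
  have "udiag f *\<^sub>v Matrix.col U l = U *\<^sub>v (mat_diag n f *\<^sub>v unit_vec n l)"
    using assms by (simp add: udiag_def mat_dim col_coords[symmetric])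
  also have "mat_diag n f *\<^sub>v unit_vec n l = f l \<cdot>\<^sub>v unit_vec n l"
    using assms by (intro eq_vecI) (auto simp: mat_diag_def)
  also have "U *\<^sub>v \<dots> = f l \<cdot>\<^sub>v Matrix.col U l"
    using assms U by (intro eq_vecI) (auto simp: mult_mat_vec[of _ n n])
  finally show ?thesis .
qed

lemma quadratic_col:
  assumes "l < n"
  shows "Matrix.col U l \<bullet> (udiag f *\<^sub>v Matrix.col U l) = f l"
  using assms U by (simp add: udiag_col col_norm)

end

lemma symmetric_mat_udiag:
  assumes "A \<in> carrier_mat n n" "transpose_mat A = A"
  obtains U d where "orthogonal_mat n U" "A = orthogonal_mat.udiag n U d"
proof -
  obtain U d where *: "U \<in> carrier_mat n n" "transpose_mat U * U = 1\<^sub>m n"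
    "A = U * mat_diag n d * transpose_mat U"
    using symmetric_mat_spectral[OF assms] by blast
  then interpret orthogonal_mat n U by unfold_locales
  show ?thesis by (rule that[OF orthogonal_mat_axioms, of d]) (simp add: * udiag_def)
qed

section \<open>Inverses, pseudoinverses and square roots\<close>

text \<open>A right inverse of a square matrix is two-sided, so \<open>A\<close> is a unit of the
  matrix ring. This excludes the outcome \<open>None\<close> of \<open>mat_inverse\<close>, and
  uniqueness of inverses does the rest.\<close>

lemma mat_inv_eqI:
  assumes A: "A \<in> carrier_mat n n" and B: "B \<in> carrier_mat n n" and AB: "A * B = 1\<^sub>m n"
  shows "mat_inv A = B"
proof -
  have BA: "B * A = 1\<^sub>m n" by (rule mat_mult_left_right_inverse[OF A B AB])
  have "A \<in> Units (ring_mat TYPE(real) n undefined)"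
    using A B AB BA by (auto simp: Units_def ring_mat_simps)
  then obtain C where C: "mat_inverse A = Some C"
    using mat_inverse(1)[OF A, where b = undefined] by (cases "mat_inverse A") auto
  then have CA: "C * A = 1\<^sub>m n" and "C \<in> carrier_mat n n"
    using mat_inverse(2)[OF A C] by auto
  then have "C = C * (A * B)" using AB by (simp add: mat_dim)
  also have "\<dots> = (C * A) * B"
    using A B \<open>C \<in> carrier_mat n n\<close> by (simp add: assoc_mult_mat_dim del: CA)
  also have "\<dots> = B" using B by (simp add: CA mat_dim)
  finally show ?thesis by (simp add: mat_inv_def C)
qed

text \<open>The condition under the definite description in \<open>pinv\<close>. Uniqueness is shown
  for every \<open>M\<close>, existence for symmetric \<open>M\<close> by diagonalization; the
  pseudoinverses that occur in the method are those of Gram matrices.\<close>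

definition penrose :: "real mat \<Rightarrow> real mat \<Rightarrow> bool" where
  "penrose M X \<longleftrightarrow> X \<in> carrier_mat (dim_col M) (dim_row M) \<and>
     M * X * M = M \<and> X * M * X = X \<and>
     transpose_mat (M * X) = M * X \<and> transpose_mat (X * M) = X * M"

text \<open>\<open>M * X\<close> and \<open>M * Y\<close> are symmetric and each absorbs the other,
  being projections onto the range of \<open>M\<close>; transposing M X = (M Y)(M X) gives M X = M
  Y. In the same way X M = Y M, whence X = X M X = X M Y = Y M Y = Y.\<close>

lemma penrose_unique:
  assumes X: "penrose M X" and Y: "penrose M Y"
  shows "X = Y"
proof -
  note p = X[unfolded penrose_def] Y[unfolded penrose_def]
  have d: "dim_row X = dim_col M" "dim_col X = dim_row M" "dim_row Y = dim_col M" "dim_col Y = dim_row M"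
    using p by auto
  have MX: "M * X = M * Y"
  proof -
    have "M * X = (M * Y) * (M * X)"
      using p d by (simp add: assoc_mult_mat_dim[symmetric])
    also have "\<dots> = transpose_mat ((M * X) * (M * Y))"
      using p d by (simp only: transpose_mult_dim index_mult_mat)
    also have "(M * X) * (M * Y) = M * Y"
      using p d by (simp add: assoc_mult_mat_dim[symmetric])
    finally show ?thesis using p by simp
  qed
  have XM: "X * M = Y * M"
  proof -
    have "X * M = (X * M) * (Y * M)"
      using p d by (simp add: assoc_mult_mat_dim)
    also have "\<dots> = transpose_mat ((Y * M) * (X * M))"
      using p d by (simp only: transpose_mult_dim index_mult_mat)
    also have "(Y * M) * (X * M) = Y * M"
      using p d by (simp add: assoc_mult_mat_dim)
    finally show ?thesis using p by simp
  qed
  have "X = X * (M * X)" using p d by (simp add: assoc_mult_mat_dim)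
  also have "\<dots> = (X * M) * Y" using d by (simp add: MX assoc_mult_mat_dim)
  also have "\<dots> = Y" using p by (simp add: XM)
  finally show ?thesis .
qed

lemma pinv_eqI: "penrose M X \<Longrightarrow> pinv M = X"
  unfolding pinv_def penrose_def[symmetric] by (blast intro: the_equality penrose_unique)

text \<open>The convention \<open>inverse 0 = 0\<close> is exactly what the Penrose equations demand
  on the kernel.\<close>

lemma (in orthogonal_mat) pinv_udiag: "pinv (udiag f) = udiag (\<lambda>i. inverse (f i))"
proof (rule pinv_eqI)
  have "(\<lambda>i. f i * inverse (f i) * f i) = f" "(\<lambda>i. inverse (f i) * f i * inverse (f i)) = (\<lambda>i. inverse (f i))"
    by (rule ext, case_tac "f i = 0", simp, simp)+
  then show "penrose (udiag f) (udiag (\<lambda>i. inverse (f i)))"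
    by (simp add: penrose_def udiag_mult udiag_transpose)
qed

text \<open>R (R - S) + (R - S) S = R^2 - S^2 = 0. Evaluated at an eigenvector u of the symmetric
  matrix R - S with eigenvalue d, this reads d (u.Ru + u.Su) = 0, and positive definiteness forces d
  = 0. A symmetric matrix all of whose eigenvalues vanish is zero.\<close>

lemma sym_pos_def_sqrt_unique:
  assumes R: "sym_pos_def n R" and S: "sym_pos_def n S" and eq: "R * R = S * S"
  shows "R = S"
proof -
  have c: "R \<in> carrier_mat n n" "S \<in> carrier_mat n n" "transpose_mat R = R" "transpose_mat S = S"
    using R S by (auto simp: sym_pos_def_def)
  have D: "R - S \<in> carrier_mat n n" "transpose_mat (R - S) = R - S"
    using c by (auto simp: transpose_minus[of _ n n])
  obtain U d where orth: "orthogonal_mat n U" and d: "R - S = orthogonal_mat.udiag n U d"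
    using symmetric_mat_udiag[OF D] by blast
  interpret orthogonal_mat n U by (rule orth)
  have "d l = 0" if l: "l < n" for l
  proof -
    let ?u = "Matrix.col U l"
    have u: "?u \<in> carrier_vec n" using l by simp
    have u0: "?u \<noteq> 0\<^sub>v n" using col_norm[OF l] by auto
    have zero_mv: "0\<^sub>m n n *\<^sub>v v = 0\<^sub>v n" if "v \<in> carrier_vec n" for v :: "real vec"
      using that by (intro eq_vecI) auto
    have Du: "(R - S) *\<^sub>v ?u = d l \<cdot>\<^sub>v ?u" by (simp only: d udiag_col[OF l])
    have "R * (R - S) + (R - S) * S = 0\<^sub>m n n"
      using c by (simp add: mult_minus_distrib_mat[of _ n n _ n] minus_mult_distrib_mat[of _ n n _ _ n] eq)
        (intro eq_matI; simp)
    then have "?u \<bullet> ((R * (R - S) + (R - S) * S) *\<^sub>v ?u) = 0"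
      using u zero_mv[of ?u] by simp
    moreover have "?u \<bullet> ((R * (R - S) + (R - S) * S) *\<^sub>v ?u)
        = ?u \<bullet> (R *\<^sub>v ((R - S) *\<^sub>v ?u)) + ?u \<bullet> ((R - S) *\<^sub>v (S *\<^sub>v ?u))"
      using c u by (simp add: add_mult_distrib_mat_vec[of _ n n] mat_dim scalar_prod_add_distrib[of _ n]
          minus_carrier_mat)
    moreover have "?u \<bullet> ((R - S) *\<^sub>v (S *\<^sub>v ?u)) = ((R - S) *\<^sub>v ?u) \<bullet> (S *\<^sub>v ?u)"
      using transpose_vec_mult_scalar[OF D(1), of "S *\<^sub>v ?u" ?u] D(2) c u by (simp add: mat_dim)
    ultimately have "d l * (?u \<bullet> (R *\<^sub>v ?u) + ?u \<bullet> (S *\<^sub>v ?u)) = 0"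
      using c u by (simp add: Du mult_mat_vec[of _ n n] mat_dim distrib_left)
    moreover have "?u \<bullet> (R *\<^sub>v ?u) > 0" "?u \<bullet> (S *\<^sub>v ?u) > 0"
      using R S u u0 by (auto simp: sym_pos_def_def)
    ultimately show ?thesis by simp
  qed
  then have "R - S = udiag (\<lambda>_. 0)" unfolding d by (rule udiag_cong)
  then have "(R - S) $$ (i, j) = 0" if "i < n" "j < n" for i j
    using that by (simp add: udiag_index)
  then show ?thesis using c by (intro eq_matI) auto
qed

lemma (in orthogonal_mat) sym_pos_def_udiag_pos:
  assumes "sym_pos_def n (udiag d)" and l: "l < n"
  shows "d l > 0"
proof -
  have "Matrix.col U l \<noteq> 0\<^sub>v n" using col_norm[OF l] by auto
  then have "Matrix.col U l \<bullet> (udiag d *\<^sub>v Matrix.col U l) > 0"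
    using assms by (auto simp: sym_pos_def_def)
  then show ?thesis using quadratic_col[OF l] by simp
qed

lemma sym_pos_def_sqrt_exists:
  assumes B: "sym_pos_def n B"
  obtains R where "sym_pos_def n R" "R * R = B"
proof -
  obtain U d where orth: "orthogonal_mat n U" and d: "B = orthogonal_mat.udiag n U d"
    using symmetric_mat_udiag[of B n] B by (auto simp: sym_pos_def_def)
  interpret orthogonal_mat n U by (rule orth)
  note dpos = sym_pos_def_udiag_pos[OF B[unfolded d]]
  define R where "R = udiag (\<lambda>l. sqrt (d l))"
  have "R * R = B" unfolding R_def udiag_mult d by (intro udiag_cong) (use dpos in force)
  moreover have "x \<bullet> (R *\<^sub>v x) > 0" if x: "x \<in> carrier_vec n" "x \<noteq> 0\<^sub>v n" for x
  proof -
    let ?y = "transpose_mat U *\<^sub>v x"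
    have "(\<Sum>l<n. (?y $ l)\<^sup>2) \<noteq> 0" using scalar_prod_self_pos[OF x] parseval[OF x(1)] by simp
    then obtain l where l: "l < n" "?y $ l \<noteq> 0"
      by (metis (mono_tags, lifting) lessThan_iff power_zero_numeral sum.neutral)
    then have "0 < (\<Sum>l<n. sqrt (d l) * (?y $ l)\<^sup>2)"
      using dpos by (intro sum_pos2[of _ l]) (auto simp: less_imp_le)
    then show ?thesis by (simp add: R_def udiag_quadratic x)
  qed
  ultimately show ?thesis
    using that[of R] by (simp add: sym_pos_def_def R_def udiag_transpose)
qed

lemma mat_sqrt:
  assumes "sym_pos_def n B"
  shows "sym_pos_def n (mat_sqrt B)" "mat_sqrt B * mat_sqrt B = B"
proof -
  have n: "dim_row B = n" using assms by (auto simp: sym_pos_def_def)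
  obtain R where R: "sym_pos_def n R" "R * R = B" using sym_pos_def_sqrt_exists[OF assms] .
  have "mat_sqrt B = R"
    unfolding mat_sqrt_def n using R sym_pos_def_sqrt_unique by (intro the_equality) auto
  with R show "sym_pos_def n (mat_sqrt B)" "mat_sqrt B * mat_sqrt B = B" by auto
qed

lemma sym_pos_def_inverse:
  assumes B: "sym_pos_def n B"
  shows "mat_inv B \<in> carrier_mat n n" "transpose_mat (mat_inv B) = mat_inv B"
    "B * mat_inv B = 1\<^sub>m n" "mat_inv B * B = 1\<^sub>m n"
proof -
  obtain U d where orth: "orthogonal_mat n U" and d: "B = orthogonal_mat.udiag n U d"
    using symmetric_mat_udiag[of B n] B by (auto simp: sym_pos_def_def)
  interpret orthogonal_mat n U by (rule orth)
  note dpos = sym_pos_def_udiag_pos[OF B[unfolded d]]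
  let ?I = "udiag (\<lambda>l. inverse (d l))"
  have BI: "B * ?I = 1\<^sub>m n"
    unfolding d udiag_mult udiag_one[symmetric] by (intro udiag_cong) (use dpos in force)
  then have I: "mat_inv B = ?I" by (intro mat_inv_eqI[of _ n]) (auto simp: d)
  show "mat_inv B \<in> carrier_mat n n" "transpose_mat (mat_inv B) = mat_inv B" "B * mat_inv B = 1\<^sub>m n"
    by (simp_all add: I udiag_transpose BI)
  then show "mat_inv B * B = 1\<^sub>m n" by (intro mat_mult_left_right_inverse[of B n]) (simp_all add: d)
qed

section \<open>Orthogonal projections\<close>

definition range_proj :: "real mat \<Rightarrow> real mat" where
  "range_proj C = C * pinv (transpose_mat C * C) * transpose_mat C"

text \<open>\<open>N\<close> and its pseudoinverse are diagonal in the same orthonormal basis, which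
  accounts for the symmetry and for the two matrices commuting.\<close>

lemma gram_pinv:
  assumes C: "C \<in> carrier_mat n q"
  defines "N \<equiv> transpose_mat C * C"
  shows "pinv N \<in> carrier_mat q q" "transpose_mat (pinv N) = pinv N"
    "N * pinv N * N = N" "pinv N * N * pinv N = pinv N" "N * pinv N = pinv N * N"
proof -
  have N: "N \<in> carrier_mat q q" "transpose_mat N = N"
    using C by (simp_all add: N_def mat_dim)
  obtain U d where orth: "orthogonal_mat q U" and d: "N = orthogonal_mat.udiag q U d"
    using symmetric_mat_udiag[OF N] by blast
  interpret orthogonal_mat q U by (rule orth)
  have inv: "d i * inverse (d i) * d i = d i" "inverse (d i) * d i * inverse (d i) = inverse (d i)" for i
    by (cases "d i = 0"; simp)+
  show "pinv N \<in> carrier_mat q q" "transpose_mat (pinv N) = pinv N"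
    "N * pinv N * N = N" "pinv N * N * pinv N = pinv N"
    unfolding d pinv_udiag udiag_mult by (simp_all add: udiag_transpose inv)
  show "N * pinv N = pinv N * N"
    unfolding d pinv_udiag udiag_mult by (simp add: mult.commute)
qed

text \<open>The diagonal entries of the Gram matrix are the squared norms of the columns.\<close>

lemma mult_transpose_self_eq_0:
  fixes C :: "real mat"
  assumes C: "C \<in> carrier_mat n q" and 0: "transpose_mat C * C = 0\<^sub>m q q"
  shows "C = 0\<^sub>m n q"
proof (rule eq_matI)
  fix i j assume "i < dim_row (0\<^sub>m n q :: real mat)" "j < dim_col (0\<^sub>m n q :: real mat)"
  then have ij: "i < n" "j < q" by auto
  have "Matrix.col C j \<bullet> Matrix.col C j = (transpose_mat C * C) $$ (j, j)" using C ij by simp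
  also have "\<dots> = 0" using ij by (simp add: 0)
  finally have "Matrix.col C j = 0\<^sub>v n"
    using C ij by (intro scalar_prod_self_eq_0) auto
  then have "Matrix.col C j $ i = 0" using ij by simp
  then show "C $$ (i, j) = 0\<^sub>m n q $$ (i, j)" using C ij by simp
qed (use C in auto)

context
  fixes n q :: nat and C :: "real mat"
  assumes C: "C \<in> carrier_mat n q"
begin

private abbreviation "N \<equiv> transpose_mat C * C"

lemma range_proj_carrier: "range_proj C \<in> carrier_mat n n"
  using C gram_pinv[OF C] by (simp add: range_proj_def mat_dim)

lemma range_proj_transpose: "transpose_mat (range_proj C) = range_proj C"
  using C gram_pinv[OF C] by (simp add: range_proj_def mat_dim)

lemma range_proj_idem: "range_proj C * range_proj C = range_proj C"
proof -
  note g = gram_pinv[OF C]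
  have "range_proj C * range_proj C = C * (pinv N * N * pinv N) * transpose_mat C"
    using C g(1) by (simp add: range_proj_def mat_dim)
  then show ?thesis by (simp only: g(4) range_proj_def)
qed

text \<open>The factor \<open>C\<close> cannot be cancelled from the Penrose equation for
  \<open>N\<close>. Instead the defect \<open>D\<close> is shown to have a vanishing Gram matrix,
  since that Gram matrix contains the factor N N^+ N - N = 0.\<close>

lemma range_proj_mult: "range_proj C * C = C"
proof -
  note g = gram_pinv[OF C]
  define D where "D = C * pinv N * N - C"
  have D: "D \<in> carrier_mat n q" using C by (simp add: D_def minus_carrier_mat)
  have "transpose_mat D * D = (N * pinv N - 1\<^sub>m q) * (N * pinv N * N - N)"
  proof -
    have "D = C * (pinv N * N - 1\<^sub>m q)"
      using C g(1) by (simp add: D_def mult_minus_distrib_mat[of _ n q _ q] mat_dim)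
    moreover have "transpose_mat D = (N * pinv N - 1\<^sub>m q) * transpose_mat C"
      using C g(1,2) by (simp add: D_def transpose_minus[of _ n q] minus_mult_distrib_mat[of _ q q _ _ n] mat_dim)
    ultimately have "transpose_mat D * D = (N * pinv N - 1\<^sub>m q) * (N * (pinv N * N - 1\<^sub>m q))"
      using C g(1) by (simp add: mat_dim)
    also have "N * (pinv N * N - 1\<^sub>m q) = N * pinv N * N - N"
      using C g(1) by (simp add: mult_minus_distrib_mat[of _ q q _ q] mat_dim)
    finally show ?thesis .
  qed
  also have "\<dots> = 0\<^sub>m q q"
  proof -
    have "N * pinv N * N - N = 0\<^sub>m q q" unfolding g(3) using C by (intro eq_matI) simp_all
    then show ?thesis using C g(1) by (simp add: right_mult_zero_mat[of _ q q])
  qed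
  finally have "D = 0\<^sub>m n q" by (rule mult_transpose_self_eq_0[OF D])
  moreover have "C * pinv N * N = D + C"
  proof -
    have "E = (E - C) + C" if "E \<in> carrier_mat n q" for E
      using that C by (intro eq_matI) simp_all
    then show ?thesis using C g(1) by (simp add: D_def mat_dim)
  qed
  ultimately show ?thesis using C g(1) by (simp add: range_proj_def mat_dim)
qed

text \<open>This shows that the range of the projection lies in the range of C C^T. It rests on N
  N^+ N^+ = N^+ N N^+ = N^+, where \<open>N\<close> commutes with its pseudoinverse N^+.\<close>

lemma range_proj_factor:
  "range_proj C = (C * transpose_mat C) * (C * pinv N * pinv N * transpose_mat C)"
proof -
  note g = gram_pinv[OF C]
  have "(C * transpose_mat C) * (C * pinv N * pinv N * transpose_mat C) = C * (N * pinv N) * pinv N * transpose_mat C"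
    using C g(1) by (simp add: mat_dim)
  then show ?thesis by (simp only: g(4,5) range_proj_def) (use C g(1,4) in \<open>simp add: mat_dim\<close>)
qed

text \<open>Both matrices are symmetric and each one fixes the range of the other.\<close>

lemma range_proj_udiag:
  assumes orth: "orthogonal_mat n U" and w: "C * transpose_mat C = orthogonal_mat.udiag n U w"
  shows "range_proj C = orthogonal_mat.udiag n U (\<lambda>l. if w l = 0 then 0 else 1)"
proof -
  interpret orthogonal_mat n U by (rule orth)
  let ?W = "C * transpose_mat C" and ?P = "range_proj C"
  define Q where "Q = udiag (\<lambda>l. if w l = 0 then 0 else 1)"
  note P = range_proj_carrier
  have Q: "Q \<in> carrier_mat n n" "transpose_mat Q = Q" by (simp_all add: Q_def udiag_transpose)
  have QW: "Q * ?W = ?W" unfolding w Q_def udiag_mult by (rule udiag_cong) simp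
  \<comment> \<open>As \<open>inverse 0 = 0\<close>, the product \<open>w l * inverse (w l)\<close>
    is the indicator of \<open>w l \<noteq> 0\<close>. Written this way, \<open>Q\<close> begins
    with the factor \<open>C\<close>, which \<open>range_proj C\<close> fixes.\<close>
  have WY: "Q = ?W * udiag (\<lambda>l. inverse (w l))" unfolding w Q_def udiag_mult by (rule udiag_cong) simp
  have "Q * ?P = (Q * ?W) * (C * pinv N * pinv N * transpose_mat C)"
    using C Q gram_pinv(1)[OF C] by (subst range_proj_factor) (simp add: mat_dim)
  then have QP: "Q * ?P = ?P" by (simp only: QW range_proj_factor[symmetric])
  have "?P * Q = (?P * C) * transpose_mat C * udiag (\<lambda>l. inverse (w l))"
    using C P by (subst WY) (simp add: mat_dim)
  then have PQ: "?P * Q = Q" by (simp only: range_proj_mult WY[symmetric])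
  have "?P = transpose_mat (Q * ?P)" by (simp only: QP range_proj_transpose)
  also have "\<dots> = ?P * Q" using P Q by (simp add: mat_dim range_proj_transpose)
  finally show ?thesis unfolding PQ by (simp only: Q_def)
qed

text \<open>Measurability of the projection in \<^term>\<open>C\<close> is read off this limit, whose terms have entries that
  are rational functions of the entries of \<^term>\<open>C * transpose_mat C\<close>. The factor
  \<open>1 / (1 + tr (C C\<^sup>T))\<close> brings the spectrum of \<^term>\<open>C * transpose_mat C\<close> into \<open>[0, 1)\<close>.\<close>

lemma range_proj_limit:
  assumes ij: "i < n" "j < n"
  defines "W \<equiv> C * transpose_mat C"
  defines "a \<equiv> 1 / (1 + (\<Sum>l<n. W $$ (l, l)))"
  shows "(\<lambda>k. (1\<^sub>m n - (1\<^sub>m n - a \<cdot>\<^sub>m W) ^\<^sub>m k) $$ (i, j)) \<longlonglongrightarrow> range_proj C $$ (i, j)"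
proof -
  have W: "W \<in> carrier_mat n n" "transpose_mat W = W" using C by (simp_all add: W_def mat_dim)
  obtain U w where orth: "orthogonal_mat n U" and w: "W = orthogonal_mat.udiag n U w"
    using symmetric_mat_udiag[OF W] by blast
  interpret orthogonal_mat n U by (rule orth)
  have w0: "w l \<ge> 0" if l: "l < n" for l
  proof -
    let ?u = "Matrix.col U l"
    have "w l = ?u \<bullet> (W *\<^sub>v ?u)" using quadratic_col[OF l] w by simp
    also have "\<dots> = (transpose_mat C *\<^sub>v ?u) \<bullet> (transpose_mat C *\<^sub>v ?u)"
      using transpose_vec_mult_scalar[OF C, of "transpose_mat C *\<^sub>v ?u" ?u] C l
      by (simp add: W_def mat_dim)
    finally show ?thesis using scalar_prod_self_nonneg by simp
  qed
  have tr: "(\<Sum>l<n. W $$ (l, l)) = (\<Sum>l<n. w l)"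
  proof -
    have "(\<Sum>l<n. W $$ (l, l)) = (\<Sum>l<n. \<Sum>k<n. w k * (U $$ (l, k) * U $$ (l, k)))"
      unfolding w by (intro sum.cong refl) (simp add: udiag_index mult_ac)
    also have "\<dots> = (\<Sum>k<n. w k * (\<Sum>l<n. U $$ (l, k) * U $$ (l, k)))"
      by (subst sum.swap) (simp add: sum_distrib_left)
    also have "\<dots> = (\<Sum>k<n. w k)"
    proof (intro sum.cong refl)
      fix k assume "k \<in> {..<n}"
      then have "(\<Sum>l<n. U $$ (l, k) * U $$ (l, k)) = 1"
        using col_norm[of k] by (simp add: scalar_prod_def lessThan_atLeast0)
      then show "w k * (\<Sum>l<n. U $$ (l, k) * U $$ (l, k)) = w k" by simp
    qed
    finally show ?thesis .
  qed
  \<comment> \<open>Nonnegative eigenvalues are bounded by their sum, the trace. The summand 1 keeps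
    the denominator positive when \<open>C\<close> vanishes and makes the second inequality
    strict.\<close>
  have a: "0 < a" "a * w l < 1" if "l < n" for l
  proof -
    have "w l \<le> (\<Sum>l<n. w l)" using w0 that by (intro member_le_sum) auto
    moreover have "(\<Sum>l<n. w l) \<ge> 0" using w0 by (intro sum_nonneg) auto
    ultimately show "0 < a" "a * w l < 1" by (auto simp: a_def tr field_simps)
  qed
  have "1\<^sub>m n - (1\<^sub>m n - a \<cdot>\<^sub>m W) ^\<^sub>m k = udiag (\<lambda>l. 1 - (1 - a * w l) ^ k)" for k
    by (simp add: w udiag_smult udiag_minus udiag_pow flip: udiag_one)
  moreover have "range_proj C = udiag (\<lambda>l. if w l = 0 then 0 else 1)"
    using range_proj_udiag[OF orth] w by (simp add: W_def)
  \<comment> \<open>The limit is taken separately on each eigenvalue: on the kernel the sequence is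
    constantly 0, elsewhere \<open>1 - a * w l\<close> lies strictly between 0 and 1 and its powers
    vanish.\<close>
  moreover have "(\<lambda>k. 1 - (1 - a * w l) ^ k) \<longlonglongrightarrow> (if w l = 0 then 0 else 1)" if l: "l < n" for l
  proof (cases "w l = 0")
    case False
    then have "0 < w l" using w0[OF l] by simp
    then have "0 < a * w l" using a[OF l] by simp
    then have "(\<lambda>k. (1 - a * w l) ^ k) \<longlonglongrightarrow> 0" using a(2)[OF l] by (intro LIMSEQ_realpow_zero) auto
    then show ?thesis using False tendsto_diff[OF tendsto_const[of 1]] by fastforce
  qed simp
  ultimately show ?thesis
    using ij by (auto simp: udiag_index intro!: tendsto_sum tendsto_mult tendsto_const)
qed

text \<open>Symmetry and idempotence turn x.Px into the squared norm of Px, and x.x - x.Px into that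
  of x - Px.\<close>

lemma range_proj_quadratic:
  assumes x: "x \<in> carrier_vec n"
  shows "0 \<le> x \<bullet> (range_proj C *\<^sub>v x)" "x \<bullet> (range_proj C *\<^sub>v x) \<le> x \<bullet> x"
proof -
  let ?P = "range_proj C"
  note P = range_proj_carrier
  have Px: "?P *\<^sub>v x \<in> carrier_vec n" using P by (simp add: mat_dim)
  have PP: "x \<bullet> (?P *\<^sub>v x) = (?P *\<^sub>v x) \<bullet> (?P *\<^sub>v x)"
    using transpose_vec_mult_scalar[OF P Px x] P x
    by (simp add: range_proj_transpose range_proj_idem flip: assoc_mult_mat_vec_dim)
  then show "0 \<le> x \<bullet> (?P *\<^sub>v x)" by (simp add: scalar_prod_self_nonneg)
  have "0 \<le> (x - ?P *\<^sub>v x) \<bullet> (x - ?P *\<^sub>v x)" by (rule scalar_prod_self_nonneg)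
  also have "\<dots> = x \<bullet> x - x \<bullet> (?P *\<^sub>v x)"
    using x Px comm_scalar_prod[OF Px x] PP
    by (simp add: minus_scalar_prod_distrib[of _ n] scalar_prod_minus_distrib[of _ n])
  finally show "x \<bullet> (?P *\<^sub>v x) \<le> x \<bullet> x" by simp
qed

text \<open>The diagonal entry p = P_ii is the sum of the squares of row i, because P = P P^T. Hence
  p^2 <= p, so p <= 1, and every other entry of the row has square at most p. The bound is uniform
  in \<open>C\<close>.\<close>

lemma range_proj_abs_le_1:
  assumes ij: "i < n" "j < n"
  shows "\<bar>range_proj C $$ (i, j)\<bar> \<le> 1"
proof -
  let ?P = "range_proj C"
  note P = range_proj_carrier
  have row: "?P $$ (i, i) = (\<Sum>k<n. (?P $$ (i, k))\<^sup>2)"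
  proof -
    have "?P $$ (i, i) = (\<Sum>k<n. ?P $$ (i, k) * ?P $$ (k, i))"
      using P ij(1) by (subst range_proj_idem[symmetric]) (simp add: scalar_prod_def lessThan_atLeast0)
    then show ?thesis
      using symmetric_mat_index[OF P range_proj_transpose] ij(1) by (simp add: power2_eq_square)
  qed
  have le: "(?P $$ (i, k))\<^sup>2 \<le> ?P $$ (i, i)" if "k < n" for k
    unfolding row using that by (intro member_le_sum) auto
  have "?P $$ (i, i) \<le> 1"
  proof (rule ccontr)
    assume "\<not> ?P $$ (i, i) \<le> 1"
    then have "?P $$ (i, i) * 1 < ?P $$ (i, i) * ?P $$ (i, i)" by (intro mult_strict_left_mono) auto
    then show False using le[OF ij(1)] by (simp add: power2_eq_square)
  qed
  then have "(?P $$ (i, j))\<^sup>2 \<le> 1" using le[OF ij(2)] by linarith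
  then show ?thesis by (simp add: abs_square_le_1)
qed

end

section \<open>Measurability\<close>

text \<open>Instantiated below with the measurable functions, which suit the unbounded matrix
  \<open>S S\<^sup>T\<close>, and with the bounded measurable ones, which have expectations.\<close>

locale function_algebra =
  fixes \<Omega> :: "'w set" and F :: "('w \<Rightarrow> real) set"
  assumes const_in [intro]: "(\<lambda>_. c) \<in> F"
    and add_in [intro]: "f \<in> F \<Longrightarrow> g \<in> F \<Longrightarrow> (\<lambda>w. f w + g w) \<in> F"
    and mult_in [intro]: "f \<in> F \<Longrightarrow> g \<in> F \<Longrightarrow> (\<lambda>w. f w * g w) \<in> F"
    and cong_in: "f \<in> F \<Longrightarrow> (\<And>w. w \<in> \<Omega> \<Longrightarrow> f w = g w) \<Longrightarrow> g \<in> F"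
begin

lemma sum_in: "(\<And>i. i \<in> I \<Longrightarrow> f i \<in> F) \<Longrightarrow> (\<lambda>w. \<Sum>i\<in>I. f i w) \<in> F"
  by (induction I rule: infinite_finite_induct) auto

lemma diff_in: "f \<in> F \<Longrightarrow> g \<in> F \<Longrightarrow> (\<lambda>w. f w - g w) \<in> F"
  using add_in[OF _ mult_in[OF const_in[of "- 1"]], of f g] by simp

definition mat_in :: "nat \<Rightarrow> nat \<Rightarrow> ('w \<Rightarrow> real mat) \<Rightarrow> bool" where
  "mat_in nr nc X \<longleftrightarrow> (\<forall>w\<in>\<Omega>. X w \<in> carrier_mat nr nc) \<and>
     (\<forall>i<nr. \<forall>j<nc. (\<lambda>w. X w $$ (i, j)) \<in> F)"

definition vec_in :: "nat \<Rightarrow> ('w \<Rightarrow> real Matrix.vec) \<Rightarrow> bool" where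
  "vec_in n v \<longleftrightarrow> (\<forall>w\<in>\<Omega>. v w \<in> carrier_vec n) \<and> (\<forall>i<n. (\<lambda>w. v w $ i) \<in> F)"

text \<open>The entries of a product or difference unfold only where the dimensions are known, that
  is on \<open>\<Omega>\<close>. Membership in \<open>F\<close> is therefore checked on a closed
  formula \<open>f i j\<close> that agrees with the entry there.\<close>

lemma mat_inI:
  assumes "\<And>w. w \<in> \<Omega> \<Longrightarrow> X w \<in> carrier_mat nr nc"
    and "\<And>i j. i < nr \<Longrightarrow> j < nc \<Longrightarrow> f i j \<in> F"
    and "\<And>i j w. i < nr \<Longrightarrow> j < nc \<Longrightarrow> w \<in> \<Omega> \<Longrightarrow> f i j w = X w $$ (i, j)"
  shows "mat_in nr nc X"
  unfolding mat_in_def using assms by (auto intro!: cong_in[OF assms(2)])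

lemma vec_inI:
  assumes "\<And>w. w \<in> \<Omega> \<Longrightarrow> v w \<in> carrier_vec n"
    and "\<And>i. i < n \<Longrightarrow> f i \<in> F"
    and "\<And>i w. i < n \<Longrightarrow> w \<in> \<Omega> \<Longrightarrow> f i w = v w $ i"
  shows "vec_in n v"
  unfolding vec_in_def using assms by (auto intro!: cong_in[OF assms(2)])

lemma mat_in_index: "mat_in nr nc X \<Longrightarrow> i < nr \<Longrightarrow> j < nc \<Longrightarrow> (\<lambda>w. X w $$ (i, j)) \<in> F"
  by (auto simp: mat_in_def)

lemma vec_in_index: "vec_in n v \<Longrightarrow> i < n \<Longrightarrow> (\<lambda>w. v w $ i) \<in> F"
  by (auto simp: vec_in_def)

lemma mat_in_const: "A \<in> carrier_mat nr nc \<Longrightarrow> mat_in nr nc (\<lambda>_. A)"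
  by (auto simp: mat_in_def)

lemma mat_in_mult:
  assumes X: "mat_in nr n X" and Y: "mat_in n nc Y"
  shows "mat_in nr nc (\<lambda>w. X w * Y w)"
proof (rule mat_inI)
  fix i j w assume "i < nr" "j < nc" "w \<in> \<Omega>"
  moreover then have "X w \<in> carrier_mat nr n" "Y w \<in> carrier_mat n nc" using X Y by (auto simp: mat_in_def)
  ultimately show "(\<Sum>k<n. X w $$ (i, k) * Y w $$ (k, j)) = (X w * Y w) $$ (i, j)"
    by (simp add: scalar_prod_def lessThan_atLeast0)
qed (use X Y in \<open>auto simp: mat_in_def intro!: sum_in\<close>)

lemma mat_in_minus:
  assumes X: "mat_in nr nc X" and Y: "mat_in nr nc Y"
  shows "mat_in nr nc (\<lambda>w. X w - Y w)"
proof (rule mat_inI)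
  fix i j w assume "i < nr" "j < nc" "w \<in> \<Omega>"
  moreover then have "X w \<in> carrier_mat nr nc" "Y w \<in> carrier_mat nr nc" using X Y by (auto simp: mat_in_def)
  ultimately show "X w $$ (i, j) - Y w $$ (i, j) = (X w - Y w) $$ (i, j)" by simp
qed (use X Y in \<open>auto simp: mat_in_def intro!: diff_in minus_carrier_mat\<close>)

lemma mat_in_smult:
  assumes a: "a \<in> F" and X: "mat_in nr nc X"
  shows "mat_in nr nc (\<lambda>w. a w \<cdot>\<^sub>m X w)"
proof (rule mat_inI)
  fix i j w assume "i < nr" "j < nc" "w \<in> \<Omega>"
  moreover then have "X w \<in> carrier_mat nr nc" using X by (auto simp: mat_in_def)
  ultimately show "a w * X w $$ (i, j) = (a w \<cdot>\<^sub>m X w) $$ (i, j)" by simp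
qed (use a X in \<open>auto simp: mat_in_def\<close>)

lemma mat_in_pow:
  assumes X: "mat_in n n X"
  shows "mat_in n n (\<lambda>w. X w ^\<^sub>m k)"
proof (induction k)
  case 0
  show ?case
    by (rule mat_inI[where f = "\<lambda>i j _. if i = j then 1 else 0"]) (use X in \<open>auto simp: mat_in_def\<close>)
next
  case (Suc k)
  then show ?case using mat_in_mult[OF Suc X] by simp
qed

lemma vec_in_const: "v \<in> carrier_vec n \<Longrightarrow> vec_in n (\<lambda>_. v)"
  by (auto simp: vec_in_def)

lemma vec_in_mult:
  assumes X: "mat_in nr n X" and v: "vec_in n v"
  shows "vec_in nr (\<lambda>w. X w *\<^sub>v v w)"
proof (rule vec_inI)
  fix i w assume "i < nr" "w \<in> \<Omega>"
  moreover then have "X w \<in> carrier_mat nr n" "v w \<in> carrier_vec n" using X v by (auto simp: mat_in_def vec_in_def)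
  ultimately show "(\<Sum>k<n. X w $$ (i, k) * v w $ k) = (X w *\<^sub>v v w) $ i"
    by (simp add: scalar_prod_def lessThan_atLeast0)
qed (use X v in \<open>auto simp: mat_in_def vec_in_def intro!: sum_in mult_mat_vec_carrier\<close>)

lemma vec_in_minus:
  assumes u: "vec_in n u" and v: "vec_in n v"
  shows "vec_in n (\<lambda>w. u w - v w)"
proof (rule vec_inI)
  fix i w assume "i < n" "w \<in> \<Omega>"
  moreover then have "u w \<in> carrier_vec n" "v w \<in> carrier_vec n" using u v by (auto simp: vec_in_def)
  ultimately show "u w $ i - v w $ i = (u w - v w) $ i" by simp
qed (use u v in \<open>auto simp: vec_in_def intro!: diff_in\<close>)

end

text \<open>The bound holds at every point instead of almost everywhere. It is thus preserved by
  composition with any measurable map and makes sense on \<open>borel_rows m\<close>, where no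
  probability measure is fixed.\<close>

definition bounded_measurable :: "'w measure \<Rightarrow> ('w \<Rightarrow> real) set" where
  "bounded_measurable M = {f \<in> borel_measurable M. \<exists>K. \<forall>w \<in> space M. \<bar>f w\<bar> \<le> K}"

lemma bounded_measurable_borel: "f \<in> bounded_measurable M \<Longrightarrow> f \<in> borel_measurable M"
  by (simp add: bounded_measurable_def)

interpretation meas: function_algebra "space M" "borel_measurable M" for M :: "'w measure"
proof
  fix f g :: "'w \<Rightarrow> real"
  assume "f \<in> borel_measurable M" "\<And>w. w \<in> space M \<Longrightarrow> f w = g w"
  then show "g \<in> borel_measurable M" using measurable_cong[of M f g borel] by blast
qed auto

interpretation bdd: function_algebra "space M" "bounded_measurable M" for M :: "'w measure"
proof
  fix f g assume "f \<in> bounded_measurable M" "g \<in> bounded_measurable M"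
  then obtain K L where f: "f \<in> borel_measurable M" "\<And>w. w \<in> space M \<Longrightarrow> \<bar>f w\<bar> \<le> K"
    and g: "g \<in> borel_measurable M" "\<And>w. w \<in> space M \<Longrightarrow> \<bar>g w\<bar> \<le> L"
    by (auto simp: bounded_measurable_def)
  have "\<bar>f w + g w\<bar> \<le> K + L" if "w \<in> space M" for w using f(2) g(2) that by fastforce
  then show "(\<lambda>w. f w + g w) \<in> bounded_measurable M"
    using f g by (auto simp: bounded_measurable_def)
  have "\<bar>f w * g w\<bar> \<le> K * L" if "w \<in> space M" for w
    using f(2)[OF that] g(2)[OF that] by (auto simp: abs_mult intro!: mult_mono')
  then show "(\<lambda>w. f w * g w) \<in> bounded_measurable M"
    using f g by (auto simp: bounded_measurable_def)
next
  fix f g assume "f \<in> bounded_measurable M" "\<And>w. w \<in> space M \<Longrightarrow> f w = g w"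
  then show "g \<in> bounded_measurable M"
    using measurable_cong[of M f g borel] by (simp add: bounded_measurable_def)
qed (auto simp: bounded_measurable_def)

lemma bounded_measurable_compose:
  assumes f: "f \<in> bounded_measurable N" and g: "g \<in> measurable M N"
  shows "(\<lambda>w. f (g w)) \<in> bounded_measurable M"
proof -
  from f obtain K where "f \<in> borel_measurable N" "\<forall>w \<in> space N. \<bar>f w\<bar> \<le> K"
    by (auto simp: bounded_measurable_def)
  then have "(\<lambda>w. f (g w)) \<in> borel_measurable M" "\<forall>w \<in> space M. \<bar>f (g w)\<bar> \<le> K"
    using g measurable_space[OF g] by auto
  then show ?thesis by (auto simp: bounded_measurable_def)
qed

lemma bdd_mat_in_compose:
  assumes X: "bdd.mat_in N nr nc X" and g: "g \<in> measurable M N"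
  shows "bdd.mat_in M nr nc (\<lambda>w. X (g w))"
  unfolding bdd.mat_in_def
proof (intro conjI ballI allI impI)
  fix i j assume "i < nr" "j < nc"
  then have "(\<lambda>w. X w $$ (i, j)) \<in> bounded_measurable N" using X by (simp add: bdd.mat_in_def)
  then show "(\<lambda>w. X (g w) $$ (i, j)) \<in> bounded_measurable M" by (rule bounded_measurable_compose[OF _ g])
qed (use X measurable_space[OF g] in \<open>simp add: bdd.mat_in_def\<close>)

lemma bdd_vec_in_compose:
  assumes v: "bdd.vec_in N n v" and g: "g \<in> measurable M N"
  shows "bdd.vec_in M n (\<lambda>w. v (g w))"
  unfolding bdd.vec_in_def
proof (intro conjI ballI allI impI)
  fix i assume "i < n"
  then have "(\<lambda>w. v w $ i) \<in> bounded_measurable N" using v by (simp add: bdd.vec_in_def)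
  then show "(\<lambda>w. v (g w) $ i) \<in> bounded_measurable M" by (rule bounded_measurable_compose[OF _ g])
qed (use v measurable_space[OF g] in \<open>simp add: bdd.vec_in_def\<close>)

section \<open>Measurable functions of a matrix with a variable number of columns\<close>

lemma space_borel_rows: "space (borel_rows m) = (\<Union>q. carrier_mat m q)"
  unfolding borel_rows_def by (rule space_measure_of) auto

lemma sets_borel_rows:
  "carrier_mat m q \<in> sets (borel_rows m)"
  "i < m \<Longrightarrow> j < q \<Longrightarrow> {X \<in> carrier_mat m q. X $$ (i, j) \<le> a} \<in> sets (borel_rows m)"
proof -
  let ?G = "range (carrier_mat m) \<union>
      {{X \<in> carrier_mat m q. X $$ (i, j) \<le> a} | q i j a. i < m \<and> j < q} :: real mat set set"
  have s: "sets (borel_rows m) = sigma_sets (\<Union>q. carrier_mat m q) ?G"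
    unfolding borel_rows_def by (rule sets_measure_of) auto
  show "carrier_mat m q \<in> sets (borel_rows m)" unfolding s by (rule sigma_sets.Basic) auto
  show "{X \<in> carrier_mat m q. X $$ (i, j) \<le> a} \<in> sets (borel_rows m)" if "i < m" "j < q"
    unfolding s using that by (intro sigma_sets.Basic) blast
qed

lemma measurable_dim_col: "dim_col \<in> measurable (borel_rows m) (count_space UNIV)"
proof (rule measurable_count_space_eq2_countable[THEN iffD2])
  show "dim_col \<in> space (borel_rows m) \<rightarrow> UNIV \<and>
    (\<forall>q\<in>UNIV. dim_col -` {q} \<inter> space (borel_rows m) \<in> sets (borel_rows m))"
  proof safe
    fix q
    have "dim_col -` {q} \<inter> space (borel_rows m) = carrier_mat m q"
      by (auto simp: space_borel_rows)
    then show "dim_col -` {q} \<inter> space (borel_rows m) \<in> sets (borel_rows m)"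
      by (simp add: sets_borel_rows)
  qed simp
qed

text \<open>The default value 0 for missing columns gives one function on all matrices with
  \<open>m\<close> rows, whose sublevel sets are countable unions over the number of
  columns.\<close>

lemma measurable_mat_entry:
  assumes i: "i < m"
  shows "(\<lambda>X. if l < dim_col X then X $$ (i, l) else 0) \<in> borel_measurable (borel_rows m)"
proof (rule borel_measurableI_le)
  fix a :: real
  have *: "X \<in> carrier_mat m (dim_col X)" if "X \<in> carrier_mat m q" for X :: "real mat" and q
    using that by auto
  have "{X \<in> space (borel_rows m). (if l < dim_col X then X $$ (i, l) else 0) \<le> a}
      = (\<Union>q. if l < q then {X \<in> carrier_mat m q. X $$ (i, l) \<le> a}
             else if 0 \<le> a then carrier_mat m q else {})"
    by (auto simp: space_borel_rows split: if_splits)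
  also have "\<dots> \<in> sets (borel_rows m)"
    using i sets_borel_rows by (intro sets.countable_UN) auto
  finally show "{X \<in> space (borel_rows m). (if l < dim_col X then X $$ (i, l) else 0) \<le> a}
      \<in> sets (borel_rows m)" .
qed

text \<open>S S^T has the fixed size m x m. Each entry is a sum whose length is the number of
  columns: it is measurable for every fixed length, and \<open>dim_col\<close> selects among
  countably many lengths.\<close>

lemma meas_gram: "meas.mat_in (borel_rows m) m m (\<lambda>S. S * transpose_mat S)"
proof -
  let ?h = "\<lambda>i l X. if l < dim_col X then X $$ (i, l) else (0 :: real)"
  show ?thesis
  proof (rule meas.mat_inI[where f = "\<lambda>i j X. \<Sum>l<dim_col X. ?h i l X * ?h j l X"])
  fix i j assume ij: "i < m" "j < m"
  have "(\<lambda>X. \<Sum>l<q. ?h i l X * ?h j l X) \<in> borel_measurable (borel_rows m)" for q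
    using measurable_mat_entry ij by (intro borel_measurable_sum borel_measurable_times) blast+
  from measurable_compose_countable[OF this measurable_dim_col]
  show "(\<lambda>X. \<Sum>l<dim_col X. ?h i l X * ?h j l X) \<in> borel_measurable (borel_rows m)" .
  fix X assume "X \<in> space (borel_rows m)"
  then show "(\<Sum>l<dim_col X. ?h i l X * ?h j l X) = (X * transpose_mat X) $$ (i, j)"
    using ij by (auto simp: space_borel_rows scalar_prod_def lessThan_atLeast0 intro!: sum.cong)
  qed (auto simp: space_borel_rows)
qed

text \<open>The Gram matrix of the rows of L S is L (S S^T) L^T, so the approximants of the
  projection are measurable in \<open>S\<close>. They are built from the unbounded \<open>W\<close>
  and are treated as measurable functions only; the uniform bound enters for their limit.\<close>

lemma bdd_range_proj:
  assumes L: "L \<in> carrier_mat n m"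
  shows "bdd.mat_in (borel_rows m) n n (\<lambda>S. range_proj (L * S))"
proof -
  define W where "W S = L * (S * transpose_mat S) * transpose_mat L" for S
  have W: "meas.mat_in (borel_rows m) n n W"
    unfolding W_def using L by (intro meas.mat_in_mult[OF meas.mat_in_mult[OF meas.mat_in_const meas_gram]]
        meas.mat_in_const) simp_all
  have W_eq: "W S = (L * S) * transpose_mat (L * S)" if "S \<in> carrier_mat m q" for S q
    using that L by (simp add: W_def mat_dim)
  define a where "a S = 1 / (1 + (\<Sum>l<n. W S $$ (l, l)))" for S
  have a: "a \<in> borel_measurable (borel_rows m)"
    unfolding a_def using W by (intro borel_measurable_divide borel_measurable_add borel_measurable_sum)
      (auto simp: meas.mat_in_def)
  have pow: "meas.mat_in (borel_rows m) n n (\<lambda>S. 1\<^sub>m n - (1\<^sub>m n - a S \<cdot>\<^sub>m W S) ^\<^sub>m k)" for k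
    by (intro meas.mat_in_minus meas.mat_in_pow meas.mat_in_smult meas.mat_in_const a W) simp_all
  have LS: "L * S \<in> carrier_mat n q" if "S \<in> carrier_mat m q" for S q
    using that L by simp
  have "(\<lambda>S. range_proj (L * S) $$ (i, j)) \<in> bounded_measurable (borel_rows m)" if ij: "i < n" "j < n" for i j
  proof -
    have "(\<lambda>S. range_proj (L * S) $$ (i, j)) \<in> borel_measurable (borel_rows m)"
    proof (rule borel_measurable_LIMSEQ_real)
      fix S assume "S \<in> space (borel_rows m)"
      then obtain q where S: "S \<in> carrier_mat m q" by (auto simp: space_borel_rows)
      show "(\<lambda>k. (1\<^sub>m n - (1\<^sub>m n - a S \<cdot>\<^sub>m W S) ^\<^sub>m k) $$ (i, j)) \<longlonglongrightarrow> range_proj (L * S) $$ (i, j)"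
        using range_proj_limit[OF LS[OF S] ij] by (simp only: a_def W_eq[OF S])
    qed (use pow ij in \<open>auto simp: meas.mat_in_def\<close>)
    moreover have "\<bar>range_proj (L * S) $$ (i, j)\<bar> \<le> 1" if "S \<in> space (borel_rows m)" for S
      using that range_proj_abs_le_1[OF LS ij] by (auto simp: space_borel_rows)
    ultimately show ?thesis by (auto simp: bounded_measurable_def)
  qed
  moreover have "range_proj (L * S) \<in> carrier_mat n n" if "S \<in> space (borel_rows m)" for S
  proof -
    from that obtain q where "S \<in> carrier_mat m q" by (auto simp: space_borel_rows)
    then show ?thesis using range_proj_carrier LS by blast
  qed
  ultimately show ?thesis by (simp add: bdd.mat_in_def)
qed

section \<open>The sketching step\<close>

text \<open>The iterate after \<open>k\<close> steps depends on the sketches with index below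
  \<open>k\<close> alone; this is how it becomes a function of variables independent of the next
  sketch.\<close>

lemma iterate_cong: "(\<And>j. j < k \<Longrightarrow> s j = t j) \<Longrightarrow> iterate A b B x0 s k = iterate A b B x0 t k"
  by (induction k) simp_all

locale sketch =
  fixes m n :: nat and A B :: "real mat"
  assumes A [simp]: "A \<in> carrier_mat m n" and B: "sym_pos_def n B"
begin

definition "R = mat_sqrt B"
definition "R' = mat_inv R"

lemma R_spd: "sym_pos_def n R" and RR: "R * R = B"
  using mat_sqrt[OF B] by (simp_all add: R_def)

lemma R [simp]: "R \<in> carrier_mat n n" and R_transpose [simp]: "transpose_mat R = R"
  using R_spd by (simp_all add: sym_pos_def_def)

lemma R' [simp]: "R' \<in> carrier_mat n n" and R'_transpose [simp]: "transpose_mat R' = R'"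
  and RR' [simp]: "R * R' = 1\<^sub>m n" and R'R [simp]: "R' * R = 1\<^sub>m n"
  using sym_pos_def_inverse[OF R_spd] by (simp_all add: R'_def)

lemma dims [simp]: "dim_row A = m" "dim_col A = n" "dim_row R = n" "dim_col R = n" "dim_row R' = n" "dim_col R' = n"
  using carrier_matD[OF A] carrier_matD[OF R] carrier_matD[OF R'] by simp_all

lemma RR'_cancel: "dim_row X = n \<Longrightarrow> R * (R' * X) = X"
  by (simp add: one_mult_mat_dim flip: assoc_mult_mat_dim)

lemma RR'_cancel_vec: "dim_vec x = n \<Longrightarrow> R *\<^sub>v (R' *\<^sub>v x) = x"
  and R'R_cancel_vec: "dim_vec x = n \<Longrightarrow> R' *\<^sub>v (R *\<^sub>v x) = x"
  using one_mult_mat_vec[OF carrier_vecI, of x n] by (simp_all flip: assoc_mult_mat_vec_dim)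

lemma mat_inv_B: "mat_inv B = R' * R'"
proof (rule mat_inv_eqI[of _ n])
  have "(R * R) * (R' * R') = 1\<^sub>m n"
    by (simp add: assoc_mult_mat_dim RR'_cancel)
  then show "B * (R' * R') = 1\<^sub>m n" by (simp only: RR)
  show "B \<in> carrier_mat n n" using B by (simp add: sym_pos_def_def)
qed (simp add: mat_dim)

definition P :: "real mat \<Rightarrow> real mat" where
  "P S = range_proj (R' * transpose_mat A * S)"

definition Z :: "real mat \<Rightarrow> real mat" where
  "Z S = sketch_Z A B S"

context
  fixes q and S :: "real mat"
  assumes S: "S \<in> carrier_mat m q"
begin

lemma S_dims [simp]: "dim_row S = m" "dim_col S = q"
  using carrier_matD[OF S] by simp_all

lemma L_carrier: "R' * transpose_mat A * S \<in> carrier_mat n q"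
  by (simp add: mat_dim)

lemma P: "P S \<in> carrier_mat n n"
  unfolding P_def by (rule range_proj_carrier[OF L_carrier])

lemma P_transpose: "transpose_mat (P S) = P S"
  unfolding P_def by (rule range_proj_transpose[OF L_carrier])

text \<open>Splitting the inverse of \<open>B\<close> evenly as \<open>R' * R'\<close> exhibits the
  matrix under the pseudoinverse of the method as a Gram matrix.\<close>

lemma gram_eq:
  "transpose_mat (R' * transpose_mat A * S) * (R' * transpose_mat A * S)
    = transpose_mat S * A * mat_inv B * transpose_mat A * S"
  by (simp add: mat_inv_B mat_dim)

lemma pinv_gram:
  "pinv (transpose_mat S * A * mat_inv B * transpose_mat A * S) \<in> carrier_mat q q"
  using gram_pinv(1)[OF L_carrier] by (simp only: gram_eq)

lemma Z_eq: "Z S = R * P S * R"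
proof -
  define G where "G = pinv (transpose_mat S * A * mat_inv B * transpose_mat A * S)"
  have G: "G \<in> carrier_mat q q" using pinv_gram by (simp add: G_def)
  have P: "P S = (R' * transpose_mat A * S) * G * transpose_mat (R' * transpose_mat A * S)"
    by (simp only: P_def range_proj_def gram_eq G_def)
  show ?thesis
    using G by (simp add: Z_def sketch_Z_def G_def[symmetric] P mat_dim RR'_cancel)
qed

lemma Z: "Z S \<in> carrier_mat n n"
  using P by (simp add: Z_eq mat_dim)

lemma Z_transpose: "transpose_mat (Z S) = Z S"
  using P by (simp add: Z_eq mat_dim P_transpose)

text \<open>At the vector \<open>R' *\<^sub>v x\<close> the outer factors \<open>R\<close> of
  \<open>Z S\<close> cancel, and the form becomes that of the projection \<open>P S\<close> at
  \<open>x\<close>.\<close>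

lemma Z_quadratic:
  assumes x: "x \<in> carrier_vec n"
  shows "0 \<le> (R' *\<^sub>v x) \<bullet> (Z S *\<^sub>v (R' *\<^sub>v x))"
    "(R' *\<^sub>v x) \<bullet> (Z S *\<^sub>v (R' *\<^sub>v x)) \<le> x \<bullet> x"
proof -
  have "(R' *\<^sub>v x) \<bullet> (Z S *\<^sub>v (R' *\<^sub>v x)) = (transpose_mat R' *\<^sub>v x) \<bullet> (R *\<^sub>v (P S *\<^sub>v x))"
    using x P by (simp add: Z_eq mat_dim RR'_cancel_vec)
  also have "\<dots> = x \<bullet> (R' *\<^sub>v (R *\<^sub>v (P S *\<^sub>v x)))"
    using x P by (intro transpose_vec_mult_scalar[of _ n n]) (simp_all add: mat_dim)
  also have "\<dots> = x \<bullet> (P S *\<^sub>v x)" using P by (simp add: R'R_cancel_vec)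
  finally show "0 \<le> (R' *\<^sub>v x) \<bullet> (Z S *\<^sub>v (R' *\<^sub>v x))"
    "(R' *\<^sub>v x) \<bullet> (Z S *\<^sub>v (R' *\<^sub>v x)) \<le> x \<bullet> x"
    using range_proj_quadratic[OF L_carrier x] by (simp_all add: P_def)
qed

text \<open>Consistency replaces the residual A x - b by A (x - xs), and the trailing factor
  \<open>A\<close> completes the step matrix to \<open>Z S\<close>.\<close>

lemma sketch_step:
  assumes x: "x \<in> carrier_vec n" and xs: "xs \<in> carrier_vec n" and b: "A *\<^sub>v xs = b"
  shows "x - (mat_inv B * transpose_mat A * S *
        pinv (transpose_mat S * A * mat_inv B * transpose_mat A * S) * transpose_mat S) *\<^sub>v (A *\<^sub>v x - b) - xs
    = (x - xs) - mat_inv B *\<^sub>v (Z S *\<^sub>v (x - xs))"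
proof -
  define G where "G = pinv (transpose_mat S * A * mat_inv B * transpose_mat A * S)"
  have G: "G \<in> carrier_mat q q" using pinv_gram by (simp add: G_def)
  have ZG: "Z S = transpose_mat A * S * G * transpose_mat S * A"
    by (simp only: Z_def sketch_Z_def G_def)
  have "A *\<^sub>v x - b = A *\<^sub>v (x - xs)"
    using x xs by (simp add: b[symmetric] mult_minus_distrib_mat_vec[of _ m n])
  then have "(mat_inv B * transpose_mat A * S * G * transpose_mat S) *\<^sub>v (A *\<^sub>v x - b)
      = mat_inv B *\<^sub>v (Z S *\<^sub>v (x - xs))"
    using x xs G ZG by (simp add: mat_dim mat_inv_B)
  moreover have "x - d - xs = (x - xs) - d" if "d \<in> carrier_vec n" for d
    using x xs that by (intro eq_vecI) auto
  moreover have "mat_inv B *\<^sub>v (Z S *\<^sub>v (x - xs)) \<in> carrier_vec n"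
    by (simp add: mat_inv_B mat_dim)
  ultimately show ?thesis by (simp add: G_def)
qed

end

lemma bdd_Z: "bdd.mat_in (borel_rows m) n n Z"
proof -
  have RPR: "bdd.mat_in (borel_rows m) n n (\<lambda>S. R * P S * R)"
    unfolding P_def
    by (rule bdd.mat_in_mult[OF bdd.mat_in_mult[OF bdd.mat_in_const[OF R] bdd_range_proj] bdd.mat_in_const[OF R]])
      (simp add: mat_dim)
  have "R * P S * R = Z S" if "S \<in> space (borel_rows m)" for S
    using that Z_eq by (auto simp: space_borel_rows)
  with RPR show ?thesis
    by (intro bdd.mat_inI[where f = "\<lambda>i j S. (R * P S * R) $$ (i, j)"]) (simp_all add: bdd.mat_in_def)
qed

lemma iterate_carrier: "x0 \<in> carrier_vec n \<Longrightarrow> iterate A b B x0 s k \<in> carrier_vec n"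
  by (induction k) (auto simp: mat_inv_B intro!: carrier_vecI)

context
  fixes b x0 xs :: "real Matrix.vec"
  assumes x0: "x0 \<in> carrier_vec n" and xs: "xs \<in> carrier_vec n" and b: "A *\<^sub>v xs = b"
begin

lemma iterate_error_Suc:
  assumes "s k \<in> space (borel_rows m)"
  shows "iterate A b B x0 s (Suc k) - xs = (iterate A b B x0 s k - xs)
    - mat_inv B *\<^sub>v (Z (s k) *\<^sub>v (iterate A b B x0 s k - xs))"
  using assms sketch_step[OF _ iterate_carrier[OF x0] xs b] by (auto simp: space_borel_rows)

text \<open>The index set is any superset of \<open>{..<k}\<close>: in the induction step the error
  after \<open>k\<close> steps is needed on a product space that already has the coordinate
  \<open>k\<close>.\<close>

lemma bdd_iterate_error:
  "{..<k} \<subseteq> I \<Longrightarrow> bdd.vec_in (PiM I (\<lambda>_. borel_rows m)) n (\<lambda>s. iterate A b B x0 s k - xs)"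
proof (induction k)
  case 0
  show ?case using x0 xs by (auto intro: bdd.vec_in_const)
next
  case (Suc k)
  let ?M = "PiM I (\<lambda>_. borel_rows m)" and ?e = "\<lambda>s. iterate A b B x0 s k - xs"
  have k: "k \<in> I" using Suc.prems by auto
  have e: "bdd.vec_in ?M n ?e" using Suc by (auto simp: subset_eq)
  have "bdd.mat_in ?M n n (\<lambda>s. Z (s k))"
    by (rule bdd_mat_in_compose[OF bdd_Z measurable_component_singleton[OF k]])
  then have "bdd.vec_in ?M n (\<lambda>s. ?e s - mat_inv B *\<^sub>v (Z (s k) *\<^sub>v ?e s))"
    by (intro bdd.vec_in_minus[OF e bdd.vec_in_mult[OF bdd.mat_in_const bdd.vec_in_mult[OF _ e]]])
      (simp_all add: mat_inv_B mat_dim)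
  moreover have "?e s - mat_inv B *\<^sub>v (Z (s k) *\<^sub>v ?e s) = iterate A b B x0 s (Suc k) - xs"
    if "s \<in> space ?M" for s
  proof -
    have "s k \<in> space (borel_rows m)" using that k by (auto simp: space_PiM PiE_iff)
    then show ?thesis by (rule iterate_error_Suc[symmetric])
  qed
  ultimately show ?case
    by (intro bdd.vec_inI[where f = "\<lambda>i s. (?e s - mat_inv B *\<^sub>v (Z (s k) *\<^sub>v ?e s)) $ i"])
      (simp_all add: bdd.vec_in_def del: iterate.simps)
qed

end

end

section \<open>Expectations\<close>

context prob_space
begin

lemma integrable_bounded_measurable: "f \<in> bounded_measurable M \<Longrightarrow> integrable M f"
  by (auto simp: bounded_measurable_def intro!: integrable_const_bound AE_I2)

lemma expectation_vec_minus:
  assumes u: "bdd.vec_in M n u" and v: "bdd.vec_in M n v"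
  shows "expectation_vec M n (\<lambda>w. u w - v w) = expectation_vec M n u - expectation_vec M n v"
proof (rule eq_vecI)
  fix i assume "i < dim_vec (expectation_vec M n u - expectation_vec M n v)"
  then have i: "i < n" by (simp add: expectation_vec_def)
  have "expectation (\<lambda>w. (u w - v w) $ i) = expectation (\<lambda>w. u w $ i - v w $ i)"
  proof (intro Bochner_Integration.integral_cong refl)
    fix w assume "w \<in> space M"
    then have "v w \<in> carrier_vec n" using v by (simp add: bdd.vec_in_def)
    then show "(u w - v w) $ i = u w $ i - v w $ i" using i by simp
  qed
  also have "\<dots> = expectation (\<lambda>w. u w $ i) - expectation (\<lambda>w. v w $ i)"
    using u v i by (intro Bochner_Integration.integral_diff integrable_bounded_measurable)
      (auto simp: bdd.vec_in_def)
  finally show "expectation_vec M n (\<lambda>w. u w - v w) $ i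
      = (expectation_vec M n u - expectation_vec M n v) $ i"
    using i by (simp add: expectation_vec_def)
qed (simp add: expectation_vec_def)

text \<open>Only the products of matching entries have to factorize. This covers independent factors
  as well as a constant matrix or a constant vector.\<close>

lemma expectation_mult_mat_vec:
  assumes X: "bdd.mat_in M nr n X" and v: "bdd.vec_in M n v"
    and uncorrelated: "\<And>i j. i < nr \<Longrightarrow> j < n \<Longrightarrow>
      expectation (\<lambda>w. X w $$ (i, j) * v w $ j) = expectation (\<lambda>w. X w $$ (i, j)) * expectation (\<lambda>w. v w $ j)"
  shows "expectation_vec M nr (\<lambda>w. X w *\<^sub>v v w) = expectation_mat M nr n X *\<^sub>v expectation_vec M n v"
proof (rule eq_vecI)
  fix i assume "i < dim_vec (expectation_mat M nr n X *\<^sub>v expectation_vec M n v)"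
  then have i: "i < nr" by (simp add: expectation_mat_def)
  have "expectation (\<lambda>w. (X w *\<^sub>v v w) $ i) = expectation (\<lambda>w. \<Sum>j<n. X w $$ (i, j) * v w $ j)"
  proof (intro Bochner_Integration.integral_cong refl)
    fix w assume "w \<in> space M"
    then have "X w \<in> carrier_mat nr n" "v w \<in> carrier_vec n"
      using X v by (simp_all add: bdd.mat_in_def bdd.vec_in_def)
    then show "(X w *\<^sub>v v w) $ i = (\<Sum>j<n. X w $$ (i, j) * v w $ j)"
      using i by (simp add: scalar_prod_def lessThan_atLeast0)
  qed
  also have "\<dots> = (\<Sum>j<n. expectation (\<lambda>w. X w $$ (i, j) * v w $ j))"
    using X v i by (intro Bochner_Integration.integral_sum integrable_bounded_measurable bdd.mult_in)
      (auto simp: bdd.vec_in_def bdd.mat_in_def)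
  also have "\<dots> = (\<Sum>j<n. expectation (\<lambda>w. X w $$ (i, j)) * expectation (\<lambda>w. v w $ j))"
    using i by (intro sum.cong refl uncorrelated) auto
  finally show "expectation_vec M nr (\<lambda>w. X w *\<^sub>v v w) $ i
      = (expectation_mat M nr n X *\<^sub>v expectation_vec M n v) $ i"
    using i by (simp add: expectation_vec_def expectation_mat_def scalar_prod_def lessThan_atLeast0)
qed (simp add: expectation_vec_def expectation_mat_def)

lemma expectation_vec_const: "v \<in> carrier_vec n \<Longrightarrow> expectation_vec M n (\<lambda>_. v) = v"
  by (intro eq_vecI) (auto simp: expectation_vec_def prob_space)

lemma expectation_mat_const: "Q \<in> carrier_mat nr n \<Longrightarrow> expectation_mat M nr n (\<lambda>_. Q) = Q"
  by (intro eq_matI) (auto simp: expectation_mat_def prob_space)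

lemma expectation_mult_const_vec:
  assumes Q: "Q \<in> carrier_mat nr n" and v: "bdd.vec_in M n v"
  shows "expectation_vec M nr (\<lambda>w. Q *\<^sub>v v w) = Q *\<^sub>v expectation_vec M n v"
  using expectation_mult_mat_vec[OF bdd.mat_in_const[OF Q] v] by (simp add: expectation_mat_const[OF Q] prob_space)

lemma expectation_mat_quadratic:
  assumes X: "bdd.mat_in M n n X" and y: "y \<in> carrier_vec n"
  shows "expectation (\<lambda>w. y \<bullet> (X w *\<^sub>v y)) = y \<bullet> (expectation_mat M n n X *\<^sub>v y)"
    and "integrable M (\<lambda>w. y \<bullet> (X w *\<^sub>v y))"
proof -
  have Xy: "bdd.vec_in M n (\<lambda>w. X w *\<^sub>v y)" by (intro bdd.vec_in_mult[OF X] bdd.vec_in_const y)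
  have eq: "y \<bullet> (X w *\<^sub>v y) = (\<Sum>i<n. y $ i * (X w *\<^sub>v y) $ i)" if "w \<in> space M" for w
  proof -
    have "X w *\<^sub>v y \<in> carrier_vec n" using Xy that by (simp add: bdd.vec_in_def)
    then show ?thesis by (simp add: scalar_prod_def[of y] lessThan_atLeast0 del: dim_mult_mat_vec)
  qed
  have int: "integrable M (\<lambda>w. y $ i * (X w *\<^sub>v y) $ i)" if "i < n" for i
    using Xy that by (intro integrable_bounded_measurable bdd.mult_in bdd.const_in) (auto simp: bdd.vec_in_def)
  show "integrable M (\<lambda>w. y \<bullet> (X w *\<^sub>v y))"
    using int by (subst Bochner_Integration.integrable_cong[OF refl eq]) auto
  have "expectation (\<lambda>w. y \<bullet> (X w *\<^sub>v y)) = (\<Sum>i<n. expectation (\<lambda>w. y $ i * (X w *\<^sub>v y) $ i))"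
    using int by (subst Bochner_Integration.integral_cong[OF refl eq]) auto
  also have "\<dots> = y \<bullet> expectation_vec M n (\<lambda>w. X w *\<^sub>v y)"
    by (simp add: scalar_prod_def expectation_vec_def lessThan_atLeast0)
  also have "expectation_vec M n (\<lambda>w. X w *\<^sub>v y) = expectation_mat M n n X *\<^sub>v y"
    using expectation_mult_mat_vec[OF X bdd.vec_in_const[OF y]]
    by (simp add: expectation_vec_const[OF y] prob_space)
  finally show "expectation (\<lambda>w. y \<bullet> (X w *\<^sub>v y)) = y \<bullet> (expectation_mat M n n X *\<^sub>v y)" .
qed

end

lemma expectation_mat_distr:
  assumes X: "bdd.mat_in N nr nc X" and f: "f \<in> measurable M N" and g: "g \<in> measurable M N"
    and eq: "distr M N f = distr M N g"
  shows "expectation_mat M nr nc (\<lambda>w. X (f w)) = expectation_mat M nr nc (\<lambda>w. X (g w))"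
proof (rule eq_matI)
  fix i j assume "i < dim_row (expectation_mat M nr nc (\<lambda>w. X (g w)))"
    "j < dim_col (expectation_mat M nr nc (\<lambda>w. X (g w)))"
  then have ij: "i < nr" "j < nc" by (simp_all add: expectation_mat_def)
  then have "(\<lambda>S. X S $$ (i, j)) \<in> borel_measurable N"
    by (intro bounded_measurable_borel bdd.mat_in_index[OF X])
  from integral_distr[OF f this] integral_distr[OF g this]
  show "expectation_mat M nr nc (\<lambda>w. X (f w)) $$ (i, j) = expectation_mat M nr nc (\<lambda>w. X (g w)) $$ (i, j)"
    using ij by (simp add: expectation_mat_def eq)
qed (simp_all add: expectation_mat_def)

section \<open>The mean sketch and one expected step of the method\<close>

locale sketch_prob = sketch m n A B + prob_space M
  for m n :: nat and A B :: "real mat" and M :: "'w measure" +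
  fixes S :: "'w \<Rightarrow> real mat"
  assumes S: "S \<in> measurable M (borel_rows m)" and n: "n > 0"
begin

definition EZ :: "real mat" where
  "EZ = expectation_mat M n n (\<lambda>w. Z (S w))"

lemma Z_S: "bdd.mat_in M n n (\<lambda>w. Z (S w))"
  by (rule bdd_mat_in_compose[OF bdd_Z S])

lemma EZ: "EZ \<in> carrier_mat n n"
  by (simp add: EZ_def expectation_mat_def)

lemma EZ_dim [simp]: "dim_row EZ = n" "dim_col EZ = n"
  using EZ by auto

lemma S_carrier:
  assumes "w \<in> space M"
  obtains q where "S w \<in> carrier_mat m q"
  using measurable_space[OF S assms] by (auto simp: space_borel_rows)

lemma EZ_transpose: "transpose_mat EZ = EZ"
proof (rule eq_matI)
  fix i j assume "i < dim_row EZ" "j < dim_col EZ"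
  then have ij: "i < n" "j < n" by auto
  have "Z (S w) $$ (j, i) = Z (S w) $$ (i, j)" if "w \<in> space M" for w
  proof -
    from S_carrier[OF that] obtain q where "S w \<in> carrier_mat m q" .
    from symmetric_mat_index[OF Z[OF this] Z_transpose[OF this]] show ?thesis using ij by blast
  qed
  then have "expectation (\<lambda>w. Z (S w) $$ (j, i)) = expectation (\<lambda>w. Z (S w) $$ (i, j))"
    by (intro Bochner_Integration.integral_cong refl)
  then show "transpose_mat EZ $$ (i, j) = EZ $$ (i, j)"
    using ij by (simp add: EZ_def expectation_mat_def)
qed auto

definition "T = 1\<^sub>m n - mat_inv B * EZ"

lemma T: "T \<in> carrier_mat n n"
  by (simp add: T_def mat_inv_B mat_dim minus_carrier_mat)

lemma expectation_iterate_error: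
  assumes x0: "x0 \<in> carrier_vec n" and xs: "xs \<in> carrier_vec n" and b: "A *\<^sub>v xs = b"
    and indep: "indep_vars (\<lambda>_. borel_rows m) Sk UNIV"
    and copies: "\<forall>k. distr M (borel_rows m) (Sk k) = distr M (borel_rows m) S"
  defines "e \<equiv> \<lambda>k w. iterate A b B x0 (\<lambda>j. Sk j w) k - xs"
  shows "expectation_vec M n (e (Suc k)) = T *\<^sub>v expectation_vec M n (e k)"
proof -
  have Sk: "Sk k \<in> measurable M (borel_rows m)" for k
    using indep by (simp add: indep_vars_def)
  have ZSk: "bdd.mat_in M n n (\<lambda>w. Z (Sk k w))" by (rule bdd_mat_in_compose[OF bdd_Z Sk])
  define F where "F = (\<lambda>s. iterate A b B x0 s k - xs)"
  have F: "bdd.vec_in (PiM {..<k} (\<lambda>_. borel_rows m)) n F"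
    unfolding F_def by (rule bdd_iterate_error[OF x0 xs b]) simp
  have F_eq: "F (restrict (\<lambda>i. Sk i w) {..<k}) = e k w" for w
    unfolding F_def e_def by (subst iterate_cong[of k _ "\<lambda>j. Sk j w"]) simp_all
  have "(\<lambda>w. restrict (\<lambda>i. Sk i w) {..<k}) \<in> measurable M (PiM {..<k} (\<lambda>_. borel_rows m))"
    by (intro measurable_restrict Sk)
  from bdd_vec_in_compose[OF F this] have e: "bdd.vec_in M n (e k)" by (simp add: F_eq)
  have ind: "indep_var borel (\<lambda>w. Z (Sk k w) $$ (i, j)) borel (\<lambda>w. e k w $ j)" if ij: "i < n" "j < n" for i j
  proof -
    have proj: "(\<lambda>s. s k) \<in> measurable (PiM {k} (\<lambda>_. borel_rows m)) (borel_rows m)"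
      by (rule measurable_component_singleton) simp
    have 1: "(\<lambda>s. Z (s k) $$ (i, j)) \<in> borel_measurable (PiM {k} (\<lambda>_. borel_rows m))"
      using bdd.mat_in_index[OF bdd_mat_in_compose[OF bdd_Z proj] ij] by (rule bounded_measurable_borel)
    have 2: "(\<lambda>s. F s $ j) \<in> borel_measurable (PiM {..<k} (\<lambda>_. borel_rows m))"
      using ij by (intro bounded_measurable_borel bdd.vec_in_index[OF F])
    \<comment> \<open>Disjoint blocks of an independent family are independent. For
      \<open>k = 0\<close> the second block is empty and the error is constant.\<close>
    have "indep_var (PiM {k} (\<lambda>_. borel_rows m)) (\<lambda>w. restrict (\<lambda>i. Sk i w) {k})
        (PiM {..<k} (\<lambda>_. borel_rows m)) (\<lambda>w. restrict (\<lambda>i. Sk i w) {..<k})"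
      by (rule indep_var_restrict[OF indep]) auto
    from indep_var_compose[OF this 1 2] show ?thesis by (simp add: o_def F_eq)
  qed
  have "expectation_vec M n (\<lambda>w. Z (Sk k w) *\<^sub>v e k w) = expectation_mat M n n (\<lambda>w. Z (Sk k w)) *\<^sub>v expectation_vec M n (e k)"
  proof (rule expectation_mult_mat_vec[OF ZSk e])
    fix i j assume ij: "i < n" "j < n"
    show "expectation (\<lambda>w. Z (Sk k w) $$ (i, j) * e k w $ j)
        = expectation (\<lambda>w. Z (Sk k w) $$ (i, j)) * expectation (\<lambda>w. e k w $ j)"
      using ZSk e ij by (intro indep_var_lebesgue_integral[OF ind[OF ij]] integrable_bounded_measurable)
        (auto simp: bdd.mat_in_def bdd.vec_in_def)
  qed
  \<comment> \<open>The expectation depends only on the law of the sketch, and \<open>Sk k\<close>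
    has the law of \<open>S\<close>.\<close>
  also have "expectation_mat M n n (\<lambda>w. Z (Sk k w)) = EZ"
    unfolding EZ_def using copies by (intro expectation_mat_distr[OF bdd_Z Sk S]) blast
  finally have EZe: "expectation_vec M n (\<lambda>w. Z (Sk k w) *\<^sub>v e k w) = EZ *\<^sub>v expectation_vec M n (e k)" .
  have Ee: "expectation_vec M n (e k) \<in> carrier_vec n" by (simp add: expectation_vec_def)
  have Bi: "mat_inv B \<in> carrier_mat n n" by (simp add: mat_inv_B mat_dim)
  have Ze: "bdd.vec_in M n (\<lambda>w. Z (Sk k w) *\<^sub>v e k w)" by (rule bdd.vec_in_mult[OF ZSk e])
  have "expectation_vec M n (e (Suc k)) = expectation_vec M n (\<lambda>w. e k w - mat_inv B *\<^sub>v (Z (Sk k w) *\<^sub>v e k w))"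
  proof -
    have "e (Suc k) w = e k w - mat_inv B *\<^sub>v (Z (Sk k w) *\<^sub>v e k w)" if "w \<in> space M" for w
      unfolding e_def by (rule iterate_error_Suc[OF x0 xs b measurable_space[OF Sk that]])
    then show ?thesis
      unfolding expectation_vec_def
      by (intro arg_cong[where f = "Matrix.vec n"] ext Bochner_Integration.integral_cong refl) simp
  qed
  also have "\<dots> = expectation_vec M n (e k) - mat_inv B *\<^sub>v (EZ *\<^sub>v expectation_vec M n (e k))"
    by (simp add: expectation_vec_minus[OF e bdd.vec_in_mult[OF bdd.mat_in_const[OF Bi] Ze]]
        expectation_mult_const_vec[OF Bi Ze] EZe)
  also have "\<dots> = T *\<^sub>v expectation_vec M n (e k)"
    using Ee Bi EZ by (simp add: T_def minus_mult_distrib_mat_vec[of _ n n] assoc_mult_mat_vec_dim)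
  finally show ?thesis .
qed

end

section \<open>The iteration matrix\<close>

text \<open>Similar matrices share their characteristic polynomial, which for a diagonal matrix
  splits visibly. The field is arbitrary because both the real and the complex spectrum of the
  iteration matrix are needed.\<close>

lemma spectrum_similar_mat_diag:
  fixes A :: "'a :: field mat"
  assumes P: "P \<in> carrier_mat n n" and Q: "Q \<in> carrier_mat n n" and PQ: "P * Q = 1\<^sub>m n"
    and A: "A = P * mat_diag n d * Q"
  shows "spectrum A = d ` {..<n}"
proof -
  let ?D = "mat_diag n d"
  have A_carrier: "A \<in> carrier_mat n n" using P Q by (simp add: A mat_dim)
  have QP: "Q * P = 1\<^sub>m n" by (rule mat_mult_left_right_inverse[OF P Q PQ])
  have "similar_mat A ?D"
    using P Q PQ QP A A_carrier by (intro similar_matI[of _ _ P Q n]) auto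
  then have "char_poly A = char_poly ?D" by (rule char_poly_similar)
  also have "\<dots> = (\<Prod>a\<leftarrow>diag_mat ?D. [:- a, 1:])"
    by (rule char_poly_upper_triangular[of _ n]) (auto simp: mat_diag_def)
  finally have "spectrum A = {k. poly (\<Prod>a\<leftarrow>diag_mat ?D. [:- a, 1:]) k = 0}"
    by (simp add: spectrum_root_char_poly[OF A_carrier])
  also have "\<dots> = set (diag_mat ?D)"
    by (auto simp: poly_prod_list prod_list_zero_iff o_def image_iff)
  also have "\<dots> = d ` {..<n}" by (auto simp: diag_mat_def mat_diag_def)
  finally show ?thesis .
qed

context sketch_prob
begin

text \<open>The matrix E[P], written in the form in which \<open>rate\<close> takes its smallest
  eigenvalue.\<close>

definition "H = R' * EZ * R'"

lemma H: "H \<in> carrier_mat n n" "transpose_mat H = H"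
  by (simp_all add: H_def mat_dim EZ_transpose)

text \<open>The pointwise bounds on the form of \<open>Z (S w)\<close> survive taking expectations.
  At unit eigenvectors they place the spectrum of \<open>H\<close> in [0, 1].\<close>

lemma H_quadratic:
  assumes x: "x \<in> carrier_vec n"
  shows "0 \<le> x \<bullet> (H *\<^sub>v x)" "x \<bullet> (H *\<^sub>v x) \<le> x \<bullet> x"
proof -
  let ?y = "R' *\<^sub>v x"
  have y: "?y \<in> carrier_vec n" by (simp add: mat_dim)
  have EZy: "EZ *\<^sub>v ?y \<in> carrier_vec n" by (simp add: mat_dim)
  have "x \<bullet> (H *\<^sub>v x) = x \<bullet> (R' *\<^sub>v (EZ *\<^sub>v ?y))"
    using x by (simp add: H_def mat_dim)
  also have "\<dots> = ?y \<bullet> (EZ *\<^sub>v ?y)"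
    using transpose_vec_mult_scalar[OF R' EZy x] by simp
  also have "\<dots> = expectation (\<lambda>w. ?y \<bullet> (Z (S w) *\<^sub>v ?y))"
    using expectation_mat_quadratic(1)[OF Z_S y] by (simp add: EZ_def)
  finally have eq: "x \<bullet> (H *\<^sub>v x) = expectation (\<lambda>w. ?y \<bullet> (Z (S w) *\<^sub>v ?y))" .
  have bounds: "0 \<le> ?y \<bullet> (Z (S w) *\<^sub>v ?y)" "?y \<bullet> (Z (S w) *\<^sub>v ?y) \<le> x \<bullet> x" if "w \<in> space M" for w
    using S_carrier[OF that] Z_quadratic[OF _ x] by blast+
  show "0 \<le> x \<bullet> (H *\<^sub>v x)"
    unfolding eq using bounds by (intro Bochner_Integration.integral_nonneg_AE AE_I2)
  have "expectation (\<lambda>w. ?y \<bullet> (Z (S w) *\<^sub>v ?y)) \<le> expectation (\<lambda>_. x \<bullet> x)"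
    using bounds by (intro integral_mono expectation_mat_quadratic(2)[OF Z_S y]) auto
  then show "x \<bullet> (H *\<^sub>v x) \<le> x \<bullet> x" by (simp add: eq prob_space)
qed

text \<open>\<open>R\<close> is an isometry onto Euclidean space, where the conjugated iteration
  matrix is symmetric.\<close>

lemma vec_norm_wrt_B:
  assumes x: "x \<in> carrier_vec n"
  shows "vec_norm_wrt B x = sqrt ((R *\<^sub>v x) \<bullet> (R *\<^sub>v x))"
proof -
  have "(R *\<^sub>v x) \<bullet> (R *\<^sub>v x) = x \<bullet> (R *\<^sub>v (R *\<^sub>v x))"
    using transpose_vec_mult_scalar[OF R _ x, of "R *\<^sub>v x"] by (simp add: mat_dim)
  also have "R *\<^sub>v (R *\<^sub>v x) = B *\<^sub>v x" using x by (simp flip: assoc_mult_mat_vec_dim add: RR)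
  finally show ?thesis by (simp add: vec_norm_wrt_def)
qed

text \<open>The spectral radius refers to the complexified matrix and \<open>lambda_max\<close> to
  real eigenvalues, so one diagonalization is used over both fields. The last two claims serve the
  geometric decay of the expected error.\<close>

lemma spectral_properties:
  defines "\<rho> \<equiv> rate B EZ"
  shows "spectral_radius (map_mat complex_of_real T) = \<rho>" "lambda_max T = \<rho>"
    "mat_norm_wrt B T = \<rho>" "0 \<le> \<rho>"
    "x \<in> carrier_vec n \<Longrightarrow> vec_norm_wrt B (T *\<^sub>v x) \<le> \<rho> * vec_norm_wrt B x"
proof -
  obtain U d where orth: "orthogonal_mat n U" and d: "H = orthogonal_mat.udiag n U d"
    using symmetric_mat_udiag[OF H] by blast
  interpret U: orthogonal_mat n U by (rule orth)
  let ?I = "{..<n}"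
  have ne: "?I \<noteq> {}" using n by (simp add: lessThan_empty_iff bot_nat_def)
  have d_bounds: "0 \<le> d l" "d l \<le> 1" if l: "l < n" for l
    using H_quadratic[of "Matrix.col U l"] U.quadratic_col[OF l] U.col_norm[OF l] l by (simp_all add: d)
  have "spectrum H = d ` ?I"
    by (rule spectrum_similar_mat_diag[of U n "transpose_mat U"]) (simp_all add: d U.udiag_def)
  then have \<rho>: "\<rho> = 1 - Min (d ` ?I)"
    by (simp add: \<rho>_def rate_def lambda_min_def H_def R'_def R_def)
  have \<rho>_ge: "1 - d l \<le> \<rho>" if "l < n" for l using that by (simp add: \<rho> Min_le)
  have "Min (d ` ?I) \<in> d ` ?I" using ne by (intro Min_in) auto
  \<comment> \<open>\<open>l0\<close> is the index of a smallest eigenvalue of \<open>H\<close>; its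
    eigenvector will attain the induced norm.\<close>
  then obtain l0 where l0: "l0 < n" "\<rho> = 1 - d l0" by (auto simp: \<rho>)
  then show \<rho>0: "0 \<le> \<rho>" using d_bounds by simp

  \<comment> \<open>The columns of \<open>V\<close> are eigenvectors of \<open>T\<close>,
    orthonormal for the inner product given by \<open>B\<close>.\<close>
  define V where "V = R' * U"
  define V' where "V' = transpose_mat U * R"
  have V: "V \<in> carrier_mat n n" "V' \<in> carrier_mat n n" by (simp_all add: V_def V'_def mat_dim)
  have VV': "V * V' = 1\<^sub>m n"
  proof -
    have "V * V' = R' * (U * transpose_mat U) * R" by (simp add: V_def V'_def mat_dim del: U.UUt)
    then show ?thesis by (simp add: mat_dim)
  qed
  let ?N = "U.udiag (\<lambda>l. 1 - d l)"
  have T_eq: "T = R' * ?N * R"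
  proof -
    have "R' * ?N * R = R' * (1\<^sub>m n - H) * R" by (simp add: d U.udiag_minus flip: U.udiag_one)
    also have "\<dots> = R' * R - R' * H * R"
      using H(1) by (simp add: mult_minus_distrib_mat[of _ n n _ n] minus_mult_distrib_mat[of _ n n _ _ n] mat_dim)
    also have "R' * H * R = mat_inv B * EZ"
      by (simp add: H_def mat_inv_B mat_dim)
    finally show ?thesis by (simp add: T_def)
  qed
  have T_sim: "T = V * mat_diag n (\<lambda>l. 1 - d l) * V'"
    by (simp add: T_eq U.udiag_def V_def V'_def mat_dim)
  have "spectrum T = (\<lambda>l. 1 - d l) ` ?I"
    by (rule spectrum_similar_mat_diag[OF V VV' T_sim])
  then have "lambda_max T = Max ((\<lambda>l. 1 - d l) ` ?I)" by (simp add: lambda_max_def)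
  also have "\<dots> = \<rho>" using l0 \<rho>_ge by (intro Max_eqI) auto
  finally show "lambda_max T = \<rho>" .

  let ?c = "map_mat complex_of_real"
  have "?c T = ?c V * ?c (mat_diag n (\<lambda>l. 1 - d l)) * ?c V'"
    using V by (simp add: T_sim of_real_hom.mat_hom_mult[of _ n n _ n] mat_dim)
  also have "?c (mat_diag n (\<lambda>l. 1 - d l)) = mat_diag n (\<lambda>l. complex_of_real (1 - d l))"
    by (intro eq_matI) (auto simp: mat_diag_def)
  finally have cT: "?c T = ?c V * mat_diag n (\<lambda>l. complex_of_real (1 - d l)) * ?c V'" .
  have "?c V * ?c V' = 1\<^sub>m n"
    using of_real_hom.mat_hom_mult[OF V, where ?'a = complex] by (simp add: VV' of_real_hom.mat_hom_one)
  then have "spectrum (?c T) = (\<lambda>l. complex_of_real (1 - d l)) ` ?I"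
    using V by (intro spectrum_similar_mat_diag[OF _ _ _ cT]) auto
  then have "spectral_radius (?c T) = Max ((\<lambda>l. norm (complex_of_real (1 - d l))) ` ?I)"
    by (simp add: spectral_radius_def image_image)
  \<comment> \<open>The bound \<open>d l \<le> 1\<close> allows the modulus to be dropped, so the
    spectral radius is the largest eigenvalue itself.\<close>
  also have "\<dots> = Max ((\<lambda>l. 1 - d l) ` ?I)"
    using d_bounds by (intro arg_cong[of _ _ Max] image_cong refl) (simp only: norm_of_real, simp)
  also have "\<dots> = \<rho>" using l0 \<rho>_ge by (intro Max_eqI) auto
  finally show "spectral_radius (?c T) = \<rho>" .

  have RT: "R *\<^sub>v (T *\<^sub>v x) = ?N *\<^sub>v (R *\<^sub>v x)" if "x \<in> carrier_vec n" for x
    using that by (simp add: T_eq mat_dim RR'_cancel_vec)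
  have norm_T: "vec_norm_wrt B (T *\<^sub>v x) \<le> \<rho> * vec_norm_wrt B x" if x: "x \<in> carrier_vec n" for x
  proof -
    let ?y = "R *\<^sub>v x"
    have y: "?y \<in> carrier_vec n" by (simp add: mat_dim)
    have Tx: "T *\<^sub>v x \<in> carrier_vec n" using T by (simp add: mat_dim)
    \<comment> \<open>In eigenbasis coordinates each squared coordinate is scaled by (1 - d l)^2,
      where 0 <= 1 - d l <= \<rho>.\<close>
    have "(?N *\<^sub>v ?y) \<bullet> (?N *\<^sub>v ?y) \<le> \<rho>\<^sup>2 * (?y \<bullet> ?y)"
      unfolding U.udiag_norm[OF y] U.parseval[OF y] sum_distrib_left
      using d_bounds \<rho>_ge by (intro sum_mono mult_right_mono power_mono) auto
    then have "sqrt ((?N *\<^sub>v ?y) \<bullet> (?N *\<^sub>v ?y)) \<le> sqrt (\<rho>\<^sup>2 * (?y \<bullet> ?y))"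
      by (rule real_sqrt_le_mono)
    also have "\<dots> = \<rho> * sqrt (?y \<bullet> ?y)" using \<rho>0 by (simp add: real_sqrt_mult)
    finally show ?thesis by (simp add: vec_norm_wrt_B[OF x] vec_norm_wrt_B[OF Tx] RT[OF x])
  qed
  then show "x \<in> carrier_vec n \<Longrightarrow> vec_norm_wrt B (T *\<^sub>v x) \<le> \<rho> * vec_norm_wrt B x" .

  have dimB: "dim_row B = n" using B by (auto simp: sym_pos_def_def)
  show "mat_norm_wrt B T = \<rho>"
    unfolding mat_norm_wrt_def dimB
  proof (rule Greatest_equality)
    \<comment> \<open>The maximum is attained at the unit eigenvector \<open>?u\<close> pulled back
      by \<open>R'\<close>, which has B-norm 1 and is scaled by exactly \<rho>.\<close>
    let ?u = "Matrix.col U l0"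
    let ?x = "R' *\<^sub>v ?u"
    have u: "?u \<in> carrier_vec n" using l0 by simp
    have x: "?x \<in> carrier_vec n" by (simp add: mat_dim)
    have Tx: "T *\<^sub>v ?x \<in> carrier_vec n" using T by (simp add: mat_dim)
    have Rx: "R *\<^sub>v ?x = ?u" using u by (simp add: RR'_cancel_vec)
    have "vec_norm_wrt B ?x = 1"
      using U.col_norm[OF l0(1)] by (simp add: vec_norm_wrt_B[OF x] Rx)
    moreover have "vec_norm_wrt B (T *\<^sub>v ?x) = \<rho>"
      using U.col_norm[OF l0(1)] l0 \<rho>0 u
      by (simp add: vec_norm_wrt_B[OF Tx] RT[OF x] Rx U.udiag_col)
    ultimately show "\<exists>x\<in>carrier_vec n. vec_norm_wrt B x = 1 \<and> \<rho> = vec_norm_wrt B (T *\<^sub>v x)"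
      using x by metis
  next
    fix r assume "\<exists>x\<in>carrier_vec n. vec_norm_wrt B x = 1 \<and> r = vec_norm_wrt B (T *\<^sub>v x)"
    then show "r \<le> \<rho>" using norm_T by fastforce
  qed
qed

end

theorem theorem4p4:
  fixes m n :: nat
    and A B :: "real mat" and b x0 :: "real vec"
    and M :: "'w measure"
    and S :: "'w \<Rightarrow> real mat" and Sk :: "nat \<Rightarrow> 'w \<Rightarrow> real mat"
  assumes n: "n > 0"
    and A: "A \<in> carrier_mat m n" and b: "b \<in> carrier_vec m"
    and consistent: "\<exists>x \<in> carrier_vec n. A *\<^sub>v x = b"
    and B: "sym_pos_def n B"
    and x0: "x0 \<in> carrier_vec n"
    and M: "prob_space M"
    and S: "S \<in> measurable M (borel_rows m)"
    and indep: "prob_space.indep_vars M (\<lambda>_. borel_rows m) Sk UNIV"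
    and copies: "\<forall>k. distr M (borel_rows m) (Sk k) = distr M (borel_rows m) S"
  defines "x \<equiv> \<lambda>k \<omega>. iterate A b B x0 (\<lambda>j. Sk j \<omega>) k"
    and "EZ \<equiv> expectation_mat M n n (\<lambda>\<omega>. sketch_Z A B (S \<omega>))"
  defines "T \<equiv> 1\<^sub>m n - mat_inv B * EZ"
    and "\<rho> \<equiv> rate B EZ"
  shows "(\<forall>xs \<in> carrier_vec n. A *\<^sub>v xs = b \<longrightarrow>
            (\<forall>k. expectation_vec M n (\<lambda>\<omega>. x (Suc k) \<omega> - xs)
                 = T *\<^sub>v expectation_vec M n (\<lambda>\<omega>. x k \<omega> - xs)))
       \<and> spectral_radius (map_mat complex_of_real T) = \<rho>
       \<and> lambda_max T = \<rho>
       \<and> mat_norm_wrt B T = \<rho>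
       \<and> (\<forall>xs \<in> carrier_vec n. A *\<^sub>v xs = b \<longrightarrow>
            (\<forall>k. vec_norm_wrt B (expectation_vec M n (\<lambda>\<omega>. x k \<omega> - xs))
                 \<le> \<rho> ^ k * vec_norm_wrt B (x0 - xs)))"
proof -
  note thm_defs = EZ_def T_def
  interpret sketch_prob m n A B M S
    using A B M S n by (intro sketch_prob.intro sketch.intro sketch_prob_axioms.intro)
  have EZ_eq: "EZ = sketch_prob.EZ n A B M S" by (simp add: thm_defs(1) EZ_def Z_def)
  have T_eq: "T = sketch_prob.T n A B M S" by (simp add: thm_defs(2) T_def EZ_eq)
  have step: "expectation_vec M n (\<lambda>\<omega>. x (Suc k) \<omega> - xs) = T *\<^sub>v expectation_vec M n (\<lambda>\<omega>. x k \<omega> - xs)"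
    if "xs \<in> carrier_vec n" "A *\<^sub>v xs = b" for xs k
    unfolding x_def T_eq by (rule expectation_iterate_error[OF x0 that indep copies])
  note sp = spectral_properties[folded EZ_eq T_eq, folded \<rho>_def]
  have "vec_norm_wrt B (expectation_vec M n (\<lambda>\<omega>. x k \<omega> - xs)) \<le> \<rho> ^ k * vec_norm_wrt B (x0 - xs)"
    if xs: "xs \<in> carrier_vec n" "A *\<^sub>v xs = b" for xs k
  proof (induction k)
    case 0
    then show ?case using x0 xs by (simp add: x_def expectation_vec_const)
  next
    case (Suc k)
    have "vec_norm_wrt B (expectation_vec M n (\<lambda>\<omega>. x (Suc k) \<omega> - xs))
        \<le> \<rho> * vec_norm_wrt B (expectation_vec M n (\<lambda>\<omega>. x k \<omega> - xs))"
      unfolding step[OF xs] by (rule sp(5)) (simp add: expectation_vec_def)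
    \<comment> \<open>Multiplying the induction hypothesis by \<rho> preserves the inequality
      because \<rho> is nonnegative.\<close>
    also have "\<dots> \<le> \<rho> * (\<rho> ^ k * vec_norm_wrt B (x0 - xs))"
      using Suc sp(4) by (rule mult_left_mono)
    finally show ?case by (simp add: mult.assoc)
  qed
  with step sp show ?thesis by blast
qed

end
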